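(* Let $n\ge 1$, let $V:\mathbf{T}^n\to\mathbf{R}$ be $C^r$ for some $r>2n+2$, let $|\cdot|^2$ be a flat Riemannian metric on $\mathbf{T}^n=\mathbf{R}^n/\mathbf{Z}^n$, and let $H_\varepsilon(q,p)=\tfrac12|p|^2+\varepsilon V(q)$ on $T^*\mathbf{T}^n$. Fix $T>0$, let $\Omega=\Omega_T\in C^r(\mathbf{R}^+,\mathbf{R}^+)$, and let $N$ be the Nosé-like (variable-mass) thermostat $$N(s,p_s)=\tfrac12\,\Omega_T(s)\,p_s^2+nkT\ln s .$$ Let $F_\varepsilon(s,q,p_s,p)=H_\varepsilon(q,p\,s^{-1})+N(s,p_s)$ on $T^*(\mathbf{R}^+\times\mathbf{T}^n)$. Then there is an open set, whose closure contains the set of thermostatic equilibria of the thermostated Hamiltonian $F_0$, on which $F_0$ is both Kolmogorov and iso-energetically non-degenerate.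
   Context: Here $\mathbf{R}^+=(0,\infty)$, $k>0$ is Boltzmann's constant, $|p|$ is the norm of a covector with respect to the dual of the metric, $(s,p_s)$ and $(q,p)$ are canonically conjugate pairs, and $T^*(\mathbf{R}^+\times\mathbf{T}^n)$ carries its canonical symplectic structure. The set of thermostatic equilibria of a thermostated Hamiltonian $F$ is the set of points at which, along the Hamiltonian flow of $F$, $\dot s=0=\dot p_s$ (this set is not assumed invariant). For $F_0$ it is $\{p_s=0,\ |p|^2=nkT\,s^2\}$. Non-degeneracy. For a completely integrable Hamiltonian written as a function $h(I)$ of action variables $I=(I_1,\dots,I_m)$, with frequency vector $\omega=[\partial h/\partial I_i]$ and $d\omega=[\partial^2h/\partial I_i\partial I_j]$, $h$ is Kolmogorov non-degenerate at $I=C$ if $\det d\omega|_{I=C}\ne0$, and iso-energetically non-degenerate at $I=C$ if $$\det\begin{bmatrix}d\omega&\omega\\ \omega^{\top}&0\end{bmatrix}_{I=C}\neq0 .$$ A Hamiltonian is non-degenerate (in either sense) on a set of phase space if it is so at the action values of every point of that set. Action variables for $F_0$. $F_0$ does not depend on $q$ (in coordinates where the metric has constant coefficients), and on $\{p\neq0\}$, for each fixed $p$, it is a one-degree-of-freedom Hamiltonian in $(s,p_s)$ with closed level curves surrounding a unique minimum, which is a thermostatic equilibrium. The $m=n+1$ action variables are $p_1,\dots,p_n$ and $A=\frac1{2\pi}\oint p_s\,ds\ge0$ (the integral over the level curve through the point; both non-degeneracy conditions are unaffected by linear changes of the actions). The thermostatic equilibria correspond to $A=0$; there the derivatives of $F_0=h(A,p)$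 are understood as those of its extension up to $A=0$. *)

theory Defs
  imports "HOL-Analysis.Analysis"
begin

section \<open>Regularity classes\<close>

text \<open>
  \<open>holder_class \<alpha> k S f\<close>: on the open set \<open>S\<close> the function \<open>f\<close> is \<open>k\<close> times continuously
  differentiable and its partial derivatives of order \<open>k\<close> are locally Hoelder continuous with
  exponent \<open>\<alpha>\<close>.  For \<open>\<alpha> = 0\<close> the Hoelder condition holds automatically, and the class is
  the usual \<open>C\<^sup>k\<close>.
\<close>

primrec holder_class ::
  "real \<Rightarrow> nat \<Rightarrow> 'a::euclidean_space set \<Rightarrow> ('a \<Rightarrow> real) \<Rightarrow> bool"
where
  "holder_class \<alpha> 0 S f \<longleftrightarrow> continuous_on S f \<and>
     (\<forall>K. compact K \<and> K \<subseteq> S \<longrightarrow>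
        (\<exists>c. \<forall>x\<in>K. \<forall>y\<in>K. \<bar>f x - f y\<bar> \<le> c * dist x y powr \<alpha>))"
| "holder_class \<alpha> (Suc k) S f \<longleftrightarrow>
     (\<exists>G. (\<forall>x\<in>S. (f has_derivative (\<lambda>v. G x \<bullet> v)) (at x)) \<and>
          (\<forall>b\<in>Basis. holder_class \<alpha> k S (\<lambda>x. G x \<bullet> b)))"

text \<open>\<open>C\<^sup>r\<close> for real \<open>r \<ge> 0\<close>; for integer \<open>r\<close> this is the usual notion.\<close>

definition Cr_on :: "real \<Rightarrow> 'a::euclidean_space set \<Rightarrow> ('a \<Rightarrow> real) \<Rightarrow> bool" where
  "Cr_on r S f \<longleftrightarrow> holder_class (frac r) (nat \<lfloor>r\<rfloor>) S f"

definition smooth_fun_on :: "'a::euclidean_space set \<Rightarrow> ('a \<Rightarrow> real) \<Rightarrow> bool" where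
  "smooth_fun_on S f \<longleftrightarrow> (\<forall>k::nat. Cr_on (real k) S f)"


section \<open>The torus and flat metrics\<close>

text \<open>
  Objects on the torus \<open>\<real>\<^sup>n/\<int>\<^sup>n\<close> are represented by their \<open>\<int>\<^sup>n\<close>-periodic lifts to
  \<open>\<real>\<^sup>n\<close>, where \<open>n = CARD('n)\<close>.
\<close>

definition lattice_periodic :: "(real^'n \<Rightarrow> 'b) \<Rightarrow> bool" where
  "lattice_periodic f \<longleftrightarrow> (\<forall>q m. (\<forall>i. m $ i \<in> \<int>) \<longrightarrow> f (q + m) = f q)"

definition riemannian_metric_on_torus :: "(real^'n \<Rightarrow> real^'n^'n) \<Rightarrow> bool" where
  "riemannian_metric_on_torus g \<longleftrightarrow>
     lattice_periodic g \<and>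
     (\<forall>i j. smooth_fun_on UNIV (\<lambda>q. g q $ i $ j)) \<and>
     (\<forall>q. transpose (g q) = g q) \<and>
     (\<forall>q v. v \<noteq> 0 \<longrightarrow> v \<bullet> (g q *v v) > 0)"

text \<open>
  \<open>\<phi>\<close> is a system of coordinates on \<open>W\<close> in which the metric \<open>g\<close> has constant coefficients
  \<open>G\<close>.  (The Jacobian is automatically invertible, because \<open>g\<close> is positive definite.)
  \<open>W\<close> may be all of \<open>\<real>\<^sup>n\<close>, so lifts of coordinate systems on the whole torus are included.
\<close>

definition flat_chart ::
  "(real^'n \<Rightarrow> real^'n^'n) \<Rightarrow> (real^'n) set \<Rightarrow> (real^'n \<Rightarrow> real^'n) \<Rightarrow> bool" where
  "flat_chart g W \<phi> \<longleftrightarrow>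
     open W \<and> inj_on \<phi> W \<and> (\<forall>i. smooth_fun_on W (\<lambda>q. \<phi> q $ i)) \<and>
     (\<exists>G. \<forall>q\<in>W. g q = transpose (jacobian \<phi> (at q)) ** G ** jacobian \<phi> (at q))"

definition flat_metric_on_torus :: "(real^'n \<Rightarrow> real^'n^'n) \<Rightarrow> bool" where
  "flat_metric_on_torus g \<longleftrightarrow>
     riemannian_metric_on_torus g \<and> (\<forall>q. \<exists>W \<phi>. flat_chart g W \<phi> \<and> q \<in> W)"

definition conorm_sq :: "(real^'n \<Rightarrow> real^'n^'n) \<Rightarrow> real^'n \<Rightarrow> real^'n \<Rightarrow> real" where
  "conorm_sq g q p = p \<bullet> (matrix_inv (g q) *v p)"


section \<open>Thermostated Hamiltonians\<close>

text \<open>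
  Points of the phase space \<open>T\<^sup>*(\<real>\<^sup>+ \<times> \<real>\<^sup>n/\<int>\<^sup>n)\<close> are written \<open>(s, q, p\<^sub>s, p)\<close> with
  \<open>s > 0\<close>, again with \<open>q\<close> lifted to \<open>\<real>\<^sup>n\<close>.
\<close>

type_synonym 'n phase = "real \<times> (real^'n) \<times> real \<times> (real^'n)"

definition phase_space :: "'n::finite phase set" where
  "phase_space = {(s, q, ps, p). s > 0}"

text \<open>Lifts of open subsets of the phase space.\<close>

definition phase_open :: "'n::finite phase set \<Rightarrow> bool" where
  "phase_open U \<longleftrightarrow> open U \<and> U \<subseteq> phase_space \<and>
     (\<forall>s ps p. lattice_periodic (\<lambda>q. (s, q, ps, p) \<in> U))"

definition mechanical_hamiltonian ::
  "(real^'n \<Rightarrow> real^'n^'n) \<Rightarrow> (real^'n \<Rightarrow> real) \<Rightarrow> real \<Rightarrow> real^'n \<Rightarrow> real^'n \<Rightarrow> real" where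
  "mechanical_hamiltonian g V \<epsilon> q p = conorm_sq g q p / 2 + \<epsilon> * V q"

definition variable_mass_thermostat ::
  "nat \<Rightarrow> real \<Rightarrow> real \<Rightarrow> (real \<Rightarrow> real) \<Rightarrow> real \<Rightarrow> real \<Rightarrow> real" where
  "variable_mass_thermostat n k T \<Omega> s ps = \<Omega> s * ps\<^sup>2 / 2 + real n * k * T * ln s"

fun thermostated ::
  "(real^'n \<Rightarrow> real^'n \<Rightarrow> real) \<Rightarrow> (real \<Rightarrow> real \<Rightarrow> real) \<Rightarrow> 'n::finite phase \<Rightarrow> real" where
  "thermostated H N (s, q, ps, p) = H q (inverse s *\<^sub>R p) + N s ps"

text \<open>The symplectic form \<open>ds \<and> dp\<^sub>s + \<Sum>\<^sub>i dq\<^sub>i \<and> dp\<^sub>i\<close>.\<close>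

fun symplectic_form :: "'n::finite phase \<Rightarrow> 'n phase \<Rightarrow> real" where
  "symplectic_form (s, q, ps, p) (s', q', ps', p') = s * ps' - ps * s' + q \<bullet> p' - p \<bullet> q'"

definition hamiltonian_vector_at ::
  "('n::finite phase \<Rightarrow> real) \<Rightarrow> 'n phase \<Rightarrow> 'n phase \<Rightarrow> bool" where
  "hamiltonian_vector_at F z X \<longleftrightarrow> (F has_derivative symplectic_form X) (at z)"

text \<open>\<open>ds\<close> and \<open>dps\<close> are the velocities of \<open>s\<close> and \<open>p\<^sub>s\<close> along the Hamiltonian flow.\<close>

definition thermostatic_equilibria :: "('n::finite phase \<Rightarrow> real) \<Rightarrow> 'n phase set" where
  "thermostatic_equilibria F =
     {z \<in> phase_space. \<exists>ds dq dps dp.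
        hamiltonian_vector_at F z (ds, dq, dps, dp) \<and> ds = 0 \<and> dps = 0}"


section \<open>Non-degeneracy of a function of action variables\<close>

text \<open>
  \<open>h\<close> is a function on the set \<open>S\<close> of action values, \<open>\<omega>\<close> is its gradient on \<open>S\<close> near \<open>C\<close> and
  \<open>d\<omega>\<close> its Hessian at \<open>C\<close>.  The derivatives are taken within \<open>S\<close>: at interior points of \<open>S\<close>
  these are the ordinary derivatives, and at a smooth boundary point those of the extension of
  \<open>h\<close> up to the boundary.
\<close>

definition frequency_data ::
  "(real^'m) set \<Rightarrow> (real^'m \<Rightarrow> real) \<Rightarrow> real^'m \<Rightarrow> (real^'m \<Rightarrow> real^'m) \<Rightarrow> real^'m^'m \<Rightarrow> bool"
where
  "frequency_data S h C \<omega> d\<omega> \<longleftrightarrow>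
     (\<exists>O'. open O' \<and> C \<in> O' \<and>
        (\<forall>I \<in> O' \<inter> S. (h has_derivative (\<lambda>v. \<omega> I \<bullet> v)) (at I within S))) \<and>
     (\<omega> has_derivative (\<lambda>v. d\<omega> *v v)) (at C within S)"

definition kolmogorov_nondegenerate_at ::
  "(real^'m) set \<Rightarrow> (real^'m \<Rightarrow> real) \<Rightarrow> real^'m \<Rightarrow> bool" where
  "kolmogorov_nondegenerate_at S h C \<longleftrightarrow>
     (\<exists>\<omega> d\<omega>. frequency_data S h C \<omega> d\<omega> \<and> det d\<omega> \<noteq> 0)"

definition bordered_matrix :: "real^'m^'m \<Rightarrow> real^'m \<Rightarrow> real^('m option)^('m option)" where
  "bordered_matrix B w = (\<chi> i j.
     case i of
       Some a \<Rightarrow> (case j of Some b \<Rightarrow> B $ a $ b | None \<Rightarrow> w $ a)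
     | None \<Rightarrow> (case j of Some b \<Rightarrow> w $ b | None \<Rightarrow> 0))"

definition isoenergetically_nondegenerate_at ::
  "(real^'m) set \<Rightarrow> (real^'m \<Rightarrow> real) \<Rightarrow> real^'m \<Rightarrow> bool" where
  "isoenergetically_nondegenerate_at S h C \<longleftrightarrow>
     (\<exists>\<omega> d\<omega>. frequency_data S h C \<omega> d\<omega> \<and> det (bordered_matrix d\<omega> (\<omega> C)) \<noteq> 0)"


section \<open>Action variables and non-degeneracy on a subset of phase space\<close>

text \<open>The level curve through a point, in the \<open>(s, p\<^sub>s)\<close> half plane, for fixed \<open>(q, p)\<close>.\<close>

fun level_curve :: "('n::finite phase \<Rightarrow> real) \<Rightarrow> 'n phase \<Rightarrow> (real \<times> real) set" where
  "level_curve F (s, q, ps, p) =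
     {(x, y). x > 0 \<and> F (x, q, y, p) = F (s, q, ps, p)}"

text \<open>
  \<open>\<gamma>\<close> runs once around the level curve.  The orientation of \<open>\<gamma>\<close> is the one that makes
  the integral non-negative.  At a minimum the level curve is a point, \<open>\<gamma>\<close> is constant and the
  action is \<open>0\<close>.
\<close>

definition thermostat_action :: "('n::finite phase \<Rightarrow> real) \<Rightarrow> 'n phase \<Rightarrow> real \<Rightarrow> bool" where
  "thermostat_action F z a \<longleftrightarrow> a \<ge> 0 \<and>
     (\<exists>\<gamma>. valid_path \<gamma> \<and> closed_path \<gamma> \<and> path_image \<gamma> = level_curve F z \<and>
          (simple_path \<gamma> \<or> (\<exists>c. level_curve F z = {c})) \<and>
          ((\<lambda>t. snd (\<gamma> t) * fst (vector_derivative \<gamma> (at t within {0..1})))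
             has_integral (2 * pi * a)) {0..1})"

definition action_domain :: "(real^'n) set \<Rightarrow> 'n::finite phase set" where
  "action_domain W = {(s, q, ps, p). s > 0 \<and> q \<in> W \<and> p \<noteq> 0}"

text \<open>
  The \<open>n + 1\<close> actions are indexed by \<open>'n option\<close>: \<open>None\<close> for \<open>A\<close> and \<open>Some i\<close> for the momentum
  conjugate to the \<open>i\<close>-th coordinate of the flat chart \<open>\<phi>\<close>.  Those momenta \<open>P\<close> are given by the
  cotangent lift, \<open>p = (D\<phi>)\<^sup>T P\<close>.  Two flat charts give momenta over the same \<open>q\<close> that differ
  by a linear map.
\<close>

definition action_variables ::
  "('n::finite phase \<Rightarrow> real) \<Rightarrow> (real^'n) set \<Rightarrow> (real^'n \<Rightarrow> real^'n) \<Rightarrow>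
     ('n phase \<Rightarrow> real^('n option)) \<Rightarrow> bool" where
  "action_variables F W \<phi> I \<longleftrightarrow>
     (\<forall>(s, q, ps, p) \<in> action_domain W.
        thermostat_action F (s, q, ps, p) (I (s, q, ps, p) $ None) \<and>
        transpose (jacobian \<phi> (at q)) *v (\<chi> i. I (s, q, ps, p) $ Some i) = p)"

text \<open>
  \<open>P\<close> is one of the two non-degeneracy conditions.  The actions \<open>I\<close>, and the values of \<open>h\<close> on
  the set of action values, are determined by \<open>F\<close> and the chart.
\<close>

definition nondegenerate_on ::
  "((real^('n option)) set \<Rightarrow> (real^('n option) \<Rightarrow> real) \<Rightarrow> real^('n option) \<Rightarrow> bool) \<Rightarrow>
     (real^'n \<Rightarrow> real^'n^'n) \<Rightarrow> ('n::finite phase \<Rightarrow> real) \<Rightarrow> 'n phase set \<Rightarrow> bool" where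
  "nondegenerate_on P g F U \<longleftrightarrow>
     (\<forall>(s, q, ps, p) \<in> U. p \<noteq> 0 \<and>
        (\<forall>W \<phi>. flat_chart g W \<phi> \<and> q \<in> W \<longrightarrow>
           (\<exists>I h. action_variables F W \<phi> I \<and>
                  (\<forall>z \<in> action_domain W. F z = h (I z)) \<and>
                  P (I ` action_domain W) h (I (s, q, ps, p)))))"

abbreviation "kolmogorov_nondegenerate_on \<equiv> nondegenerate_on kolmogorov_nondegenerate_at"
abbreviation "isoenergetically_nondegenerate_on \<equiv>
  nondegenerate_on isoenergetically_nondegenerate_at"

end

theory Submission
  imports Defs
begin

text \<open>
  Write \<open>c = n k T\<close> and let \<open>\<rho>\<close> be the norm of \<open>p\<close>. For fixed \<open>p\<close> the Hamiltonian \<open>F\<^sub>0\<close> has one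
  degree of freedom, with inverse mass \<open>\<Omega> s\<close> and potential \<open>\<rho>\<^sup>2 / (2 s\<^sup>2) + c ln s\<close>. The
  substitution \<open>s = exp (L + y)\<close> with \<open>L = ln (\<rho> / sqrt c)\<close> turns the potential into \<open>c (L + 1/2
  + x\<^sup>2)\<close>, where \<open>x\<^sup>2 = (exp (-2y) + 2y - 1) / 2\<close> depends neither on \<open>p\<close> nor on \<open>\<Omega>\<close>, and \<open>y\<close> is
  a smooth increasing function of \<open>x\<close>. With the scaled excess energy \<open>t = F\<^sub>0 / c - L - 1/2\<close>,
  the level curve is a deformed circle of radius \<open>sqrt t\<close>, along which \<open>x = sqrt t * cos \<theta>\<close>, and
  the action becomes a weighted mean over that circle: \<open>A = a(t, L) = t * mean (sin\<^sup>2 \<theta> * G (L +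
  y x) * y' x)\<close> with \<open>G l = exp l * sqrt (2 c / \<Omega> (exp l))\<close>. Solving \<open>A = a(t, L)\<close> for \<open>t\<close> gives
  \<open>h(A, p) = c (L + t + 1/2)\<close>.

  The Hessian of \<open>h\<close> is best studied with \<open>(t, p)\<close> instead of \<open>(A, p)\<close> as parameters. Where \<open>a\<^sub>t
  > a\<^sub>L\<close>, which holds near \<open>t = 0\<close>, the elements of its kernel move \<open>p\<close> only radially, and
  likewise for the bordered matrix. The question is thus reduced to the plane of \<open>t\<close> and \<open>L\<close>,
  where the two conditions become
  \<^item> Kolmogorov: \<open>K = a\<^sub>t\<^sub>t (a\<^sub>L\<^sub>L - a\<^sub>L + a\<^sub>t) - a\<^sub>t\<^sub>L\<^sup>2 \<noteq> 0\<close>;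
  \<^item> iso-energetic: \<open>J = a\<^sub>L\<^sub>L - 2 a\<^sub>t\<^sub>L + a\<^sub>t\<^sub>t - a\<^sub>L + a\<^sub>t \<noteq> 0\<close>.

  Either expression can vanish at every equilibrium \<open>t = 0\<close>, for instance for certain powers \<open>\<Omega>
  s = s powr m\<close>, so the first derivatives in \<open>t\<close> are needed as well. Integration by parts
  expresses the \<open>t\<close>-derivatives of \<open>a\<close> as means that are continuous up to \<open>t = 0\<close>, and their
  values at \<open>t = 0\<close> are differential expressions in \<open>G\<close> of order at most four; \<open>r > 2 n + 2 \<ge> 4\<close>
  supplies these derivatives. If \<open>J\<close> and \<open>J\<^sub>t\<close> both vanished at \<open>t = 0\<close> on an interval of \<open>L\<close>,
  the first equation would be \<open>G'' = 6 G' - 14/3 G\<close>, the second would then reduce to \<open>13 G' = 12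
  G\<close>, and these contradict each other as \<open>G > 0\<close>. If \<open>K\<close> and \<open>K\<^sub>t\<close> did, then \<open>\<lambda> = G' / G\<close> would
  satisfy the Riccati equation \<open>\<lambda>' = 3 \<lambda>\<^sup>2 - 2 \<lambda> - 2/3\<close> and a quartic polynomial equation, and
  differentiating the latter gives a contradiction again. Hence for a dense set of \<open>L\<close> both
  expressions are non-zero for all small \<open>t > 0\<close>, and the open set where they are non-zero
  accumulates at every equilibrium (\<open>nondegenerate_near_0\<close>, \<open>equilibria_in_closure\<close>).
\<close>

section \<open>Functions of class \<open>C\<^sup>k\<close> on the line\<close>

text \<open>
  The derivatives are two-sided, so \<open>S\<close> is meant to be open. The recursion on explicit
  derivatives makes closure under composition and inversion a matter of induction.
\<close>

primrec C_on :: "nat \<Rightarrow> real set \<Rightarrow> (real \<Rightarrow> real) \<Rightarrow> bool" where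
  "C_on 0 S f \<longleftrightarrow> continuous_on S f"
| "C_on (Suc k) S f \<longleftrightarrow> (\<exists>f'. (\<forall>x\<in>S. (f has_real_derivative f' x) (at x)) \<and> C_on k S f')"

lemma C_on_SucI:
  assumes "\<And>x. x \<in> S \<Longrightarrow> (f has_real_derivative f' x) (at x)" "C_on k S f'"
  shows "C_on (Suc k) S f"
  using assms by auto

lemma C_on_continuous: "C_on k S f \<Longrightarrow> continuous_on S f"
  by (cases k) (auto intro!: continuous_at_imp_continuous_on intro: DERIV_isCont)

lemma C_on_SucD: "C_on (Suc k) S f \<Longrightarrow> C_on k S f"
proof (induction k arbitrary: f)
  case 0 then show ?case using C_on_continuous[of "Suc 0" S f] by simp
next
  case (Suc k)
  from Suc.prems obtain f' where f': "\<And>x. x \<in> S \<Longrightarrow> (f has_real_derivative f' x) (at x)"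
    and Cf': "C_on (Suc k) S f'"
    unfolding C_on.simps(2)[of "Suc k"] by blast
  show ?case by (rule C_on_SucI[OF f' Suc.IH[OF Cf']])
qed

lemma C_on_mono: "C_on k S f \<Longrightarrow> j \<le> k \<Longrightarrow> C_on j S f"
proof (induction k)
  case (Suc k)
  then show ?case using C_on_SucD[of k S f] by (cases "j = Suc k") (auto simp del: C_on.simps)
qed simp

lemma C_on_const: "C_on k S (\<lambda>x. c)"
  by (induction k arbitrary: c) (auto intro!: exI[of _ "\<lambda>x. 0"])

lemma C_on_ident: "C_on k S (\<lambda>x. x)"
  by (cases k) (auto intro!: exI[of _ "\<lambda>x. 1"] C_on_const)

lemma C_on_add: "C_on k S f \<Longrightarrow> C_on k S g \<Longrightarrow> C_on k S (\<lambda>x. f x + g x)"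
proof (induction k arbitrary: f g)
  case 0 then show ?case by (auto intro: continuous_on_add)
next
  case (Suc k)
  then obtain f' g' where
    "\<forall>x\<in>S. (f has_real_derivative f' x) (at x)" "C_on k S f'"
    "\<forall>x\<in>S. (g has_real_derivative g' x) (at x)" "C_on k S g'" by auto
  with Suc.IH show ?case by (auto intro!: exI[of _ "\<lambda>x. f' x + g' x"] derivative_eq_intros)
qed

lemma C_on_mult: "C_on k S f \<Longrightarrow> C_on k S g \<Longrightarrow> C_on k S (\<lambda>x. f x * g x)"
proof (induction k arbitrary: f g)
  case 0 then show ?case by (auto intro: continuous_on_mult)
next
  case (Suc k)
  then obtain f' g' where fg:
    "\<forall>x\<in>S. (f has_real_derivative f' x) (at x)" "C_on k S f'"
    "\<forall>x\<in>S. (g has_real_derivative g' x) (at x)" "C_on k S g'" by auto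
  from Suc.prems have "C_on k S f" "C_on k S g" by (auto dest!: C_on_SucD simp del: C_on.simps)
  with fg have "C_on k S (\<lambda>x. f' x * g x + g' x * f x)"
    by (intro C_on_add Suc.IH)
  with fg show ?case by (auto intro!: exI[of _ "\<lambda>x. f' x * g x + g' x * f x"] derivative_eq_intros)
qed

lemma C_on_compose:
  "C_on k T f \<Longrightarrow> C_on k S g \<Longrightarrow> (\<And>x. x \<in> S \<Longrightarrow> g x \<in> T) \<Longrightarrow> C_on k S (\<lambda>x. f (g x))"
proof (induction k arbitrary: f)
  case 0 then show ?case by (auto intro: continuous_on_compose2)
next
  case (Suc k)
  then obtain f' g' where fg:
    "\<forall>x\<in>T. (f has_real_derivative f' x) (at x)" "C_on k T f'"
    "\<forall>x\<in>S. (g has_real_derivative g' x) (at x)" "C_on k S g'" by auto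
  from Suc.prems(2) have g: "C_on k S g" by (rule C_on_SucD)
  have "C_on k S (\<lambda>x. f' (g x) * g' x)"
    by (rule C_on_mult[OF Suc.IH[OF fg(2) g Suc.prems(3)] fg(4)])
  moreover have "((\<lambda>x. f (g x)) has_real_derivative f' (g x) * g' x) (at x)" if "x \<in> S" for x
    using fg Suc.prems(3) that by (intro DERIV_chain2[of f]) auto
  ultimately show ?case by (rule C_on_SucI[rotated])
qed

lemma C_on_exp: "C_on k S exp"
proof (induction k)
  case (Suc k)
  show ?case by (rule C_on_SucI[OF _ Suc]) auto
qed (auto intro!: continuous_intros)

lemma C_on_inverse: "C_on k {0<..} inverse"
proof (induction k)
  case 0 show ?case by (auto intro!: continuous_intros)
next
  case (Suc k)
  have "C_on k {0<..} (\<lambda>x. - 1 * (inverse x * inverse x))"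
    by (intro C_on_mult C_on_const Suc)
  then show ?case
    by (rule C_on_SucI[rotated]) (auto intro!: derivative_eq_intros simp: power2_eq_square)
qed

lemma C_on_sqrt: "C_on k {0<..} sqrt"
proof (induction k)
  case 0 show ?case by (auto intro!: continuous_intros)
next
  case (Suc k)
  have "C_on k {0<..} (\<lambda>x. 1 / 2 * inverse (sqrt x))"
    by (intro C_on_mult C_on_const C_on_compose[OF C_on_inverse] Suc) auto
  moreover have "(sqrt has_real_derivative 1 / 2 * inverse (sqrt x)) (at x)" if "x > 0" for x
    using DERIV_real_sqrt[OF that] by (simp add: field_simps)
  ultimately show ?case by (intro C_on_SucI[of _ sqrt "\<lambda>x. 1 / 2 * inverse (sqrt x)"]) auto
qed

lemma C_on_power_series:
  fixes c :: "nat \<Rightarrow> real"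
  assumes "\<And>x. summable (\<lambda>n. c n * x ^ n)"
  shows "C_on k UNIV (\<lambda>x. \<Sum>n. c n * x ^ n)"
  using assms
proof (induction k arbitrary: c)
  case 0
  then have "isCont (\<lambda>x. \<Sum>n. c n * x ^ n) x" for x
    using termdiffs_strong_converges_everywhere DERIV_isCont by blast
  then show ?case by (simp add: continuous_on_eq_continuous_at)
next
  case (Suc k)
  have "summable (\<lambda>n. diffs c n * x ^ n)" for x
    by (rule termdiff_converges_all) (rule Suc.prems)
  then have "C_on k UNIV (\<lambda>x. \<Sum>n. diffs c n * x ^ n)" by (rule Suc.IH)
  moreover have "((\<lambda>x. \<Sum>n. c n * x ^ n) has_real_derivative (\<Sum>n. diffs c n * x ^ n)) (at x)" for x
    by (rule termdiffs_strong_converges_everywhere) (rule Suc.prems)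
  ultimately show ?case by (intro C_on_SucI[where f' = "\<lambda>x. \<Sum>n. diffs c n * x ^ n"])
qed

lemma C_on_inverse_function:
  assumes f: "C_on (Suc k) UNIV f" and f': "\<And>x. (f has_real_derivative f' x) (at x)" "\<And>x. f' x > 0"
    and g: "continuous_on UNIV g" "\<And>x. f (g x) = x"
  shows "C_on (Suc k) UNIV g" "\<And>x. (g has_real_derivative inverse (f' (g x))) (at x)"
proof -
  show der: "(g has_real_derivative inverse (f' (g x))) (at x)" for x
  proof (rule DERIV_inverse_function[where f = f and D = "f' (g x)" and a = "x - 1" and b = "x + 1"])
    show "f' (g x) \<noteq> 0" using f'(2)[of "g x"] by simp
    show "isCont g x" using g(1) by (simp add: continuous_on_eq_continuous_at)
  qed (use f' g in auto)
  have Cf': "C_on k UNIV f'"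
  proof -
    from f obtain d where d: "\<forall>x. (f has_real_derivative d x) (at x)" "C_on k UNIV d" by auto
    then have "d = f'" using f' by (auto intro!: ext intro: DERIV_unique)
    with d show ?thesis by simp
  qed
  have "C_on j UNIV g" if "j \<le> Suc k" for j
    using that
  proof (induction j)
    case 0 then show ?case using g by simp
  next
    case (Suc j)
    have "C_on j UNIV f'"
      using Cf' by (rule C_on_mono) (use Suc.prems in simp)
    then have "C_on j UNIV (\<lambda>x. inverse (f' (g x)))"
      using f' Suc by (intro C_on_compose[OF C_on_inverse C_on_compose[of j UNIV f' UNIV g]]) auto
    then show ?case by (rule C_on_SucI[OF der])
  qed
  then show "C_on (Suc k) UNIV g" by blast
qed

lemma C_on_deriv:
  assumes "C_on (Suc k) UNIV f"
  shows "(f has_real_derivative deriv f x) (at x)" "C_on k UNIV (deriv f)"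
proof -
  from assms obtain f' where f': "\<And>x. (f has_real_derivative f' x) (at x)" "C_on k UNIV f'"
    by auto
  then have "deriv f = f'" by (intro ext DERIV_imp_deriv)
  with f' show "(f has_real_derivative deriv f x) (at x)" "C_on k UNIV (deriv f)" by simp_all
qed

lemma C_on_iterated_deriv: "C_on k UNIV f \<Longrightarrow> i \<le> k \<Longrightarrow> C_on (k - i) UNIV ((deriv ^^ i) f)"
proof (induction i)
  case (Suc i)
  then have "C_on (Suc (k - Suc i)) UNIV ((deriv ^^ i) f)"
    by (simp del: C_on.simps add: Suc_diff_Suc)
  from C_on_deriv(2)[OF this] show ?case by simp
qed simp

lemma C_on_has_iterated_deriv:
  assumes "C_on k UNIV f" "i < k"
  shows "((deriv ^^ i) f has_real_derivative (deriv ^^ Suc i) f x) (at x)"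
proof -
  have "C_on (Suc (k - Suc i)) UNIV ((deriv ^^ i) f)"
    using C_on_iterated_deriv[OF assms(1), of i] assms(2) by (simp del: C_on.simps add: Suc_diff_Suc)
  from C_on_deriv(1)[OF this] show ?thesis by simp
qed

lemma holder_class_imp_C_on:
  fixes f :: "real \<Rightarrow> real"
  assumes "holder_class \<alpha> k S f" shows "C_on k S f"
  using assms
proof (induction k arbitrary: f)
  case 0 then show ?case by simp
next
  case (Suc k)
  then obtain G where G: "\<forall>x\<in>S. (f has_derivative (\<lambda>v. G x \<bullet> v)) (at x)"
    "holder_class \<alpha> k S (\<lambda>x. G x \<bullet> 1)" by auto
  then have "C_on k S G" using Suc.IH by simp
  moreover have "(f has_real_derivative G x) (at x)" if "x \<in> S" for x
    using G(1) that by (simp add: has_field_derivative_def)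
  ultimately show ?case by auto
qed

lemma Cr_on_imp_C_on:
  fixes f :: "real \<Rightarrow> real"
  assumes "Cr_on r S f" "real k \<le> r" shows "C_on k S f"
proof (rule C_on_mono)
  show "C_on (nat \<lfloor>r\<rfloor>) S f"
    using assms(1) unfolding Cr_on_def by (rule holder_class_imp_C_on)
  show "k \<le> nat \<lfloor>r\<rfloor>" using assms(2) by (simp add: le_nat_iff le_floor_iff)
qed

section \<open>The universal coordinate of the potential well\<close>

text \<open>
  The sign makes \<open>amplitude\<close> a smooth square root of the potential at its double zero; the
  inverse function measures \<open>ln s\<close> from the bottom of the well.
\<close>

definition amplitude :: "real \<Rightarrow> real" where
  "amplitude y = sgn y * sqrt ((exp (- 2 * y) + 2 * y - 1) / 2)"

definition displacement :: "real \<Rightarrow> real" where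
  "displacement = inv amplitude"

definition disp_deriv :: "nat \<Rightarrow> real \<Rightarrow> real" where
  "disp_deriv i = (deriv ^^ i) displacement"

text \<open>
  Dividing the power series of the potential by \<open>y\<^sup>2\<close> removes the double zero, so that
  \<open>amplitude y = y * sqrt (F y)\<close> with \<open>F\<close> smooth and positive.
\<close>

lemma potential_series:
  obtains F :: "real \<Rightarrow> real" where "\<And>k. C_on k UNIV F" "F 0 = 1"
    "\<And>y. y\<^sup>2 * F y = (exp (- 2 * y) + 2 * y - 1) / 2"
proof -
  define c :: "nat \<Rightarrow> real" where "c n = (- 2) ^ (n + 2) / (2 * fact (n + 2))" for n
  have e: "(\<lambda>n. (- 2 * y) ^ (n + 2) / fact (n + 2) / 2) sums ((exp (- 2 * y) - (1 - 2 * y)) / 2)"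
      for y :: real
  proof -
    have "(\<lambda>n. (- 2 * y) ^ n / fact n) sums exp (- 2 * y)"
      using exp_converges[of "- 2 * y"] by (simp add: field_simps scaleR_conv_of_real)
    from sums_split_initial_segment[OF this, of 2] have
      "(\<lambda>n. (- 2 * y) ^ (n + 2) / fact (n + 2)) sums (exp (- 2 * y) - (1 - 2 * y))"
      by (simp add: numeral_2_eq_2)
    then show ?thesis by (rule sums_divide)
  qed
  have ce: "y\<^sup>2 * (c n * y ^ n) = (- 2 * y) ^ (n + 2) / fact (n + 2) / 2" for y n
    by (simp only: c_def power_mult_distrib power_add) (simp add: field_simps)
  have sm: "summable (\<lambda>n. c n * y ^ n)" for y
  proof (cases "y = 0")
    case False
    have "summable (\<lambda>n. y\<^sup>2 * (c n * y ^ n))"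
      unfolding ce using e by (rule sums_summable)
    with False show ?thesis by (simp only: summable_cmult_iff) simp
  qed simp
  show thesis
  proof
    show "C_on k UNIV (\<lambda>y. \<Sum>n. c n * y ^ n)" for k
      by (rule C_on_power_series) (rule sm)
    show "(\<Sum>n. c n * 0 ^ n) = 1"
      unfolding powser_zero by (simp add: c_def)
    show "y\<^sup>2 * (\<Sum>n. c n * y ^ n) = (exp (- 2 * y) + 2 * y - 1) / 2" for y
      using sums_unique[OF e[of y]] suminf_mult[OF sm[of y], of "y\<^sup>2"] unfolding ce by simp
  qed
qed

lemma potential_pos: "y \<noteq> 0 \<Longrightarrow> exp (- 2 * y) + 2 * y - 1 > (0::real)"
  using exp_minus_greater[of "2 * y"] exp_ge_add_one_self[of "- 2 * y"]
    by (auto simp: less_le)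

lemma potential_nonneg: "exp (- 2 * y) + 2 * y - 1 \<ge> (0::real)"
  using exp_ge_add_one_self[of "- 2 * y"] by simp

lemma amplitude_square: "(amplitude y)\<^sup>2 = (exp (- 2 * y) + 2 * y - 1) / 2"
  using potential_nonneg[of y] by (cases "y = 0") (auto simp: amplitude_def power_mult_distrib sgn_if)

lemma C_on_amplitude: "C_on k UNIV amplitude"
  and amplitude_deriv_pos: "\<exists>d>0. (amplitude has_real_derivative d) (at y)"
proof -
  obtain F :: "real \<Rightarrow> real" where F: "\<And>k. C_on k UNIV F" "F 0 = 1"
    "\<And>y. y\<^sup>2 * F y = (exp (- 2 * y) + 2 * y - 1) / 2" using potential_series by blast
  have Fpos: "F y > 0" for y
  proof (cases "y = 0")
    case False
    then have "y\<^sup>2 * F y > 0" using potential_pos[of y] F(3)[of y] by simp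
    with False show ?thesis by (simp add: zero_less_mult_iff)
  qed (simp add: F)
  have amp: "amplitude = (\<lambda>y. y * sqrt (F y))"
  proof
    fix y
    have "amplitude y = sgn y * sqrt (y\<^sup>2 * F y)" by (simp only: amplitude_def F(3))
    also have "\<dots> = (sgn y * \<bar>y\<bar>) * sqrt (F y)" by (simp add: real_sqrt_mult)
    also have "sgn y * \<bar>y\<bar> = y" by (rule sgn_mult_abs)
    finally show "amplitude y = y * sqrt (F y)" .
  qed
  show C: "C_on k UNIV amplitude" for k
    unfolding amp using Fpos
    by (intro C_on_mult C_on_ident C_on_compose[OF C_on_sqrt F(1)]) auto
  from C_on_deriv(1)[OF C[of "Suc 0"]]
  obtain d where d: "(amplitude has_real_derivative d y) (at y)" for y by blast
  have "d y > 0"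
  proof (cases "y = 0")
    case True
    obtain F' where F': "(F has_real_derivative F') (at 0)"
      using C_on_deriv(1)[OF F(1)[of "Suc 0"]] by blast
    have "(amplitude has_real_derivative 1) (at 0)"
      unfolding amp using F(2)
      by (auto intro!: derivative_eq_intros F')
    with d[of 0] True show ?thesis using DERIV_unique by fastforce
  next
    case False
    have "((\<lambda>y. (amplitude y)\<^sup>2) has_real_derivative 2 * amplitude y * d y) (at y)"
      by (auto intro!: derivative_eq_intros d)
    moreover have "((\<lambda>y. (amplitude y)\<^sup>2) has_real_derivative 1 - exp (- 2 * y)) (at y)"
      unfolding amplitude_square by (auto intro!: derivative_eq_intros)
    ultimately have eq: "2 * amplitude y * d y = 1 - exp (- 2 * y)" by (rule DERIV_unique)
    have *: "sqrt ((exp (- 2 * y) + 2 * y - 1) / 2) > 0"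
      using potential_pos[OF False] by simp
    have "amplitude y * (1 - exp (- 2 * y)) > 0"
    proof (cases "y > 0")
      case True
      then have "amplitude y > 0" using * by (simp add: amplitude_def)
      with True show ?thesis by (intro mult_pos_pos) auto
    next
      case y: False
      then have "amplitude y < 0" using * False by (simp add: amplitude_def)
      with y False show ?thesis by (intro mult_neg_neg) auto
    qed
    then have "2 * (amplitude y)\<^sup>2 * d y > 0" 
      unfolding eq[symmetric] by (simp add: power2_eq_square mult_ac)
    then show ?thesis by (auto simp: zero_less_mult_iff not_less)
  qed
  with d show "\<exists>d>0. (amplitude has_real_derivative d) (at y)" by blast
qed

lemma strict_mono_amplitude: "strict_mono amplitude"
  by (rule strict_monoI) (meson DERIV_pos_imp_increasing amplitude_deriv_pos)

lemma surj_amplitude: "surj amplitude"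
proof -
  have "\<exists>y. amplitude y = x" for x
  proof -
    \<comment> \<open>The potential grows linearly on the right and faster than quadratically on the left.\<close>
    have up: "x \<le> amplitude (x\<^sup>2 + 1)"
    proof -
      have "x\<^sup>2 \<le> (amplitude (x\<^sup>2 + 1))\<^sup>2" unfolding amplitude_square
        by (simp add: field_simps add_pos_nonneg less_imp_le)
      moreover have "0 \<le> amplitude (x\<^sup>2 + 1)" using potential_nonneg[of "x\<^sup>2 + 1"]
        by (simp add: amplitude_def sgn_if add_nonneg_pos)
      ultimately show ?thesis using power2_le_imp_le by blast
    qed
    have lo: "amplitude (- \<bar>x\<bar>) \<le> x"
    proof -
      have "\<bar>x\<bar>\<^sup>2 \<le> (- amplitude (- \<bar>x\<bar>))\<^sup>2"
        unfolding power2_minus amplitude_square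
        using exp_lower_Taylor_quadratic[of "2 * \<bar>x\<bar>"] by (simp add: power2_eq_square field_simps)
      moreover have "0 \<le> - amplitude (- \<bar>x\<bar>)" using potential_nonneg[of "- \<bar>x\<bar>"]
        by (simp add: amplitude_def sgn_if)
      ultimately have "\<bar>x\<bar> \<le> - amplitude (- \<bar>x\<bar>)" using power2_le_imp_le by blast
      then show ?thesis by linarith
    qed
    have "continuous_on UNIV amplitude" using C_on_amplitude C_on_continuous by blast
    then have "continuous_on {- \<bar>x\<bar>..x\<^sup>2 + 1} amplitude" by (rule continuous_on_subset) simp
    moreover have "- \<bar>x\<bar> \<le> x\<^sup>2 + 1" by (smt (verit) zero_le_power2)
    ultimately show ?thesis using IVT'[of amplitude, OF lo up] by blast
  qed
  then show ?thesis by (metis surjI)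
qed

lemma amplitude_displacement [simp]: "amplitude (displacement x) = x"
  unfolding displacement_def by (rule surj_f_inv_f[OF surj_amplitude])

lemma displacement_amplitude [simp]: "displacement (amplitude y) = y"
  unfolding displacement_def by (rule inv_f_f) (simp add: strict_mono_amplitude strict_mono_imp_inj_on)

lemma C_on_displacement: "C_on k UNIV displacement"
  and displacement_deriv_pos: "deriv displacement x > 0"
proof -
  obtain d where d: "\<And>y. d y > 0" "\<And>y. (amplitude has_real_derivative d y) (at y)"
    using amplitude_deriv_pos by metis
  have cont: "continuous_on UNIV displacement"
  proof -
    have "isCont displacement (amplitude y)" for y
      by (rule isCont_inverse_function[where d = 1]) (auto intro: DERIV_isCont d)
    then show ?thesis
      by (metis amplitude_displacement continuous_at_imp_continuous_on)
  qed
  show "C_on k UNIV displacement" for k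
    using C_on_inverse_function(1)[OF C_on_amplitude d(2,1) cont amplitude_displacement] C_on_SucD
        by blast
  have "(displacement has_real_derivative inverse (d (displacement x))) (at x)" for x
    using C_on_inverse_function(2)[OF C_on_amplitude d(2,1) cont amplitude_displacement] .
  then have "deriv displacement x = inverse (d (displacement x))" for x
    by (rule DERIV_imp_deriv)
  then show "deriv displacement x > 0" for x
    using d(1)[of "displacement x"] by simp
qed

lemma disp_deriv_DERIV: "(disp_deriv i has_real_derivative disp_deriv (Suc i) x) (at x)"
  unfolding disp_deriv_def by (rule C_on_has_iterated_deriv[OF C_on_displacement lessI])

lemma continuous_disp_deriv: "continuous_on UNIV (disp_deriv i)"
  unfolding disp_deriv_def by (rule C_on_continuous[OF C_on_iterated_deriv[OF C_on_displacement
      le_refl]])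

lemma disp_deriv_0: "disp_deriv 0 = displacement"
  by (simp add: disp_deriv_def)

lemma disp_deriv_1_pos: "disp_deriv 1 x > 0"
  using displacement_deriv_pos by (simp add: disp_deriv_def)

lemma displacement_potential: "(exp (- 2 * displacement x) + 2 * displacement x - 1) / 2 = x\<^sup>2"
  using amplitude_square[of "displacement x"] by simp

lemma displacement_0 [simp]: "displacement 0 = 0"
proof -
  have "displacement (amplitude 0) = 0" by (rule displacement_amplitude)
  then show ?thesis by (simp add: amplitude_def)
qed

text \<open>
  Differentiating the identity \<open>(exp (-2y) + 2y - 1) / 2 = x\<^sup>2\<close> repeatedly determines the
  derivatives one by one: the coefficient \<open>1 - exp (-2y)\<close> of the highest one vanishes at \<open>0\<close>,
  hence the \<open>(k + 1)\<close>-st differentiated identity gives the \<open>k\<close>-th derivative.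
\<close>

lemma displacement_Taylor:
  "disp_deriv 1 0 = 1" "disp_deriv 2 0 = 2/3" "disp_deriv 3 0 = 2/3"
  "disp_deriv 4 0 = 32/45" "disp_deriv 5 0 = 4/9"
proof -
  define Y where "Y i = disp_deriv i" for i
  define z where "z x = exp (- 2 * Y 0 x)" for x
  have Y: "(Y i has_real_derivative Y (Suc i) x) (at x)" for i x
    unfolding Y_def by (rule disp_deriv_DERIV)
  note Ys = Y[of 0, simplified] Y[of 1, simplified Suc_1] Y[of 2, simplified] Y[of 3, simplified]
      Y[of 4, simplified] Y[of 5, simplified]
  have dz: "(z has_real_derivative - 2 * Y 1 x * z x) (at x)" for x
    unfolding z_def[abs_def] by (auto intro!: derivative_eq_intros Ys)
  have Y1: "(Y (Suc 0) has_real_derivative Y 2 x) (at x)" for x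
    using Y[of 1] by (simp add: numeral_2_eq_2)
  have diff: "f' = g'" if "f = g" "\<And>x. (f has_real_derivative f' x) (at x)"
    "\<And>x. (g has_real_derivative g' x) (at x)" for f g f' g' :: "real \<Rightarrow> real"
    using that(2,3) unfolding that(1) by (intro ext) (rule DERIV_unique)
  have pw: "a ^ 2 = a * a" "a ^ 3 = a * a * a" "a ^ 4 = a * a * a * a" "a ^ 5 = a * a * a * a * a"
      for a :: real
    by (simp_all add: power_def numeral_nat)
  note di = derivative_eq_intros dz Y1 Ys
  have I0: "(\<lambda>x. (z x + 2 * Y 0 x - 1) / 2) = (\<lambda>x. x\<^sup>2)"
    unfolding z_def Y_def disp_deriv_0 using displacement_potential by (intro ext) simp
  have I1: "(\<lambda>x. Y 1 x * (1 - z x)) = (\<lambda>x. 2 * x)"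
    by (rule diff[OF I0]) (auto intro!: di simp: field_simps)
  have I2: "(\<lambda>x. Y 2 x * (1 - z x) + 2 * z x * Y 1 x ^ 2) = (\<lambda>x. 2)"
    by (rule diff[OF I1]) (auto intro!: di simp: algebra_simps pw)
  have I3: "(\<lambda>x. Y 3 x * (1 - z x) + z x * (6 * Y 1 x * Y 2 x - 4 * Y 1 x ^ 3)) = (\<lambda>x. 0)"
    by (rule diff[OF I2]) (auto intro!: di simp: algebra_simps pw)
  have I4: "(\<lambda>x. Y 4 x * (1 - z x) + z x * (8 * Y 1 x * Y 3 x + 6 * Y 2 x ^ 2 - 24 * Y 1 x ^ 2 * Y
      2 x + 8 * Y 1 x ^ 4)) = (\<lambda>x. 0)"
    by (rule diff[OF I3]) (auto intro!: di simp: algebra_simps pw)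
  have I5: "(\<lambda>x. Y 5 x * (1 - z x) + z x * (10 * Y 1 x * Y 4 x + 20 * Y 2 x * Y 3 x - 60 * Y 1 x *
      Y 2 x ^ 2
      - 40 * Y 1 x ^ 2 * Y 3 x + 80 * Y 1 x ^ 3 * Y 2 x - 16 * Y 1 x ^ 5)) = (\<lambda>x. 0)"
    by (rule diff[OF I4]) (auto intro!: di simp: algebra_simps pw)
  have I6: "(\<lambda>x. Y 6 x * (1 - z x) + 2 * z x * Y 1 x * Y 5 x
      - 2 * Y 1 x * z x * (10 * Y 1 x * Y 4 x + 20 * Y 2 x * Y 3 x - 60 * Y 1 x * Y 2 x ^ 2
      - 40 * Y 1 x ^ 2 * Y 3 x + 80 * Y 1 x ^ 3 * Y 2 x - 16 * Y 1 x ^ 5)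
      + z x * (10 * (Y 2 x * Y 4 x + Y 1 x * Y 5 x) + 20 * (Y 3 x * Y 3 x + Y 2 x * Y 4 x)
      - 60 * (Y 2 x ^ 3 + 2 * Y 1 x * Y 2 x * Y 3 x) - 40 * (2 * Y 1 x * Y 2 x * Y 3 x + Y 1 x ^ 2
      * Y 4 x)
      + 80 * (3 * Y 1 x ^ 2 * Y 2 x ^ 2 + Y 1 x ^ 3 * Y 3 x) - 80 * Y 1 x ^ 4 * Y 2 x)) = (\<lambda>x. 0)"
    by (rule diff[OF I5]) (auto intro!: di simp: algebra_simps pw)
  have z0: "z 0 = 1" by (simp add: z_def Y_def disp_deriv_0)
  have "Y 1 0 > 0" unfolding Y_def by (rule disp_deriv_1_pos)
  with fun_cong[OF I2, of 0] have y1: "Y 1 0 = 1" by (simp add: z0 power2_eq_1_iff)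
  from fun_cong[OF I3, of 0] have y2: "Y 2 0 = 2/3" by (simp add: z0 y1[simplified])
  from fun_cong[OF I4, of 0] have y3: "Y 3 0 = 2/3" by (simp add: z0 y1[simplified] y2 power2_eq_square)
  from fun_cong[OF I5, of 0] have y4: "Y 4 0 = 32/45" by (simp add: z0 y1[simplified] y2 y3
      power2_eq_square)
  from fun_cong[OF I6, of 0] have y5: "Y 5 0 = 4/9" by (simp add: z0 y1[simplified] y2 y3 y4
      power2_eq_square power3_eq_cube)
  show "disp_deriv 1 0 = 1" "disp_deriv 2 0 = 2/3" "disp_deriv 3 0 = 2/3"
    "disp_deriv 4 0 = 32/45" "disp_deriv 5 0 = 4/9"
    using y1 y2 y3 y4 y5 by (simp_all only: Y_def)
qed

section \<open>Weighted means over a circle\<close>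

definition circle_average :: "nat \<Rightarrow> (real \<Rightarrow> real) \<Rightarrow> real \<Rightarrow> real" where
  "circle_average k \<phi> R = integral {0..1} (\<lambda>u. sin (2 * pi * u) ^ k * \<phi> (R * cos (2 * pi * u)))"

lemma integral_periodic_deriv:
  fixes \<Phi> :: "real \<Rightarrow> real"
  assumes "\<And>u. (\<Phi> has_real_derivative \<Phi>' u) (at u)" "\<Phi> 1 = \<Phi> 0"
  shows "(\<Phi>' has_integral 0) {0..1}"
proof -
  have "(\<Phi>' has_integral \<Phi> 1 - \<Phi> 0) {0..1}"
    using assms(1) by (intro fundamental_theorem_of_calculus)
      (auto simp: has_real_derivative_iff_has_vector_derivative[symmetric] intro:
          has_field_derivative_at_within)
  with assms(2) show ?thesis by simp
qed

lemma has_integral_circle_average: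
  assumes "continuous_on UNIV \<phi>"
  shows "((\<lambda>u. sin (2 * pi * u) ^ k * \<phi> (R * cos (2 * pi * u))) has_integral circle_average k \<phi> R)
      {0..1}"
  unfolding circle_average_def
  by (intro integrable_integral integrable_continuous_interval continuous_intros
      continuous_on_compose2[OF assms]) auto

lemma deriv_sin_turn: "((\<lambda>u. sin (2 * pi * u)) has_real_derivative 2 * pi * cos (2 * pi * u)) (at u)"
  and deriv_cos_turn: "((\<lambda>u. cos (2 * pi * u)) has_real_derivative - (2 * pi * sin (2 * pi * u)))
  (at u)"
  by (auto intro!: derivative_eq_intros)

text \<open>
  Integrating the derivative of \<open>sin\<^bsup>k+1\<^esup> \<theta> * \<phi> (R cos \<theta>)\<close> over a full turn.
\<close>

lemma circle_average_by_parts: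
  assumes d: "\<And>x. (\<phi> has_real_derivative \<phi>' x) (at x)" and c: "continuous_on UNIV \<phi>'"
  shows "((\<lambda>u. sin (2 * pi * u) ^ k * (cos (2 * pi * u) * \<phi> (R * cos (2 * pi * u)))) has_integral
     R * circle_average (k + 2) \<phi>' R / real (k + 1)) {0..1}"
proof -
  have "((\<lambda>u. 2 * pi * (real (k + 1) * (sin (2 * pi * u) ^ k * (cos (2 * pi * u) * \<phi> (R * cos (2 *
      pi * u))))
       - R * (sin (2 * pi * u) ^ (k + 2) * \<phi>' (R * cos (2 * pi * u))))) has_integral 0) {0..1}"
  proof (rule integral_periodic_deriv[where \<Phi> = "\<lambda>u. sin (2 * pi * u) ^ (k + 1) * \<phi> (R * cos (2 *
      pi * u))"])
    show "((\<lambda>u. sin (2 * pi * u) ^ (k + 1) * \<phi> (R * cos (2 * pi * u))) has_real_derivative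
      2 * pi * (real (k + 1) * (sin (2 * pi * u) ^ k * (cos (2 * pi * u) * \<phi> (R * cos (2 * pi * u))))
       - R * (sin (2 * pi * u) ^ (k + 2) * \<phi>' (R * cos (2 * pi * u))))) (at u)" for u
      unfolding Suc_eq_plus1[symmetric]
      by (rule DERIV_cong[OF DERIV_mult[OF DERIV_power_Suc[OF deriv_sin_turn]
            DERIV_chain2[OF d DERIV_cmult[OF deriv_cos_turn]]]])
         (simp add: algebra_simps)
  qed simp
  from has_integral_divide[OF this, of "2 * pi"]
  have "((\<lambda>u. real (k + 1) * (sin (2 * pi * u) ^ k * (cos (2 * pi * u) * \<phi> (R * cos (2 * pi * u))))
       - R * (sin (2 * pi * u) ^ (k + 2) * \<phi>' (R * cos (2 * pi * u)))) has_integral 0) {0..1}"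
    by simp
  from has_integral_add[OF this has_integral_mult_right[OF has_integral_circle_average[OF c, of "k
      + 2" R], of R]]
  have "((\<lambda>u. real (k + 1) * (sin (2 * pi * u) ^ k * (cos (2 * pi * u) * \<phi> (R * cos (2 * pi * u)))))
     has_integral R * circle_average (k + 2) \<phi>' R) {0..1}" by simp
  from has_integral_divide[OF this, of "real (k + 1)"] show ?thesis by simp
qed

text \<open>
  Integrating the derivative of \<open>sin \<theta> * cos \<theta> * \<phi> (R cos \<theta>)\<close> over a full turn.
\<close>

lemma circle_average_by_parts_base:
  assumes d: "\<And>x. (\<phi> has_real_derivative \<phi>' x) (at x)" and c: "continuous_on UNIV \<phi>'"
  shows "((\<lambda>u. R * (sin (2 * pi * u) ^ 2 * (cos (2 * pi * u) * \<phi>' (R * cos (2 * pi * u))))) has_integral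
     circle_average 0 \<phi> R - 2 * circle_average 2 \<phi> R) {0..1}"
proof -
  have c0: "continuous_on UNIV \<phi>" using d by (meson DERIV_isCont continuous_at_imp_continuous_on)
  have "((\<lambda>u. 2 * pi * ((sin (2 * pi * u) ^ 0 * \<phi> (R * cos (2 * pi * u)) - 2 * (sin (2 * pi * u) ^
      2 * \<phi> (R * cos (2 * pi * u))))
       - R * (sin (2 * pi * u) ^ 2 * (cos (2 * pi * u) * \<phi>' (R * cos (2 * pi * u))))))
       has_integral 0) {0..1}"
  proof (rule integral_periodic_deriv[where \<Phi> = "\<lambda>u. sin (2 * pi * u) * cos (2 * pi * u) * \<phi> (R *
      cos (2 * pi * u))"])
    show "((\<lambda>u. sin (2 * pi * u) * cos (2 * pi * u) * \<phi> (R * cos (2 * pi * u))) has_real_derivative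
      2 * pi * ((sin (2 * pi * u) ^ 0 * \<phi> (R * cos (2 * pi * u)) - 2 * (sin (2 * pi * u) ^ 2 * \<phi>
      (R * cos (2 * pi * u))))
       - R * (sin (2 * pi * u) ^ 2 * (cos (2 * pi * u) * \<phi>' (R * cos (2 * pi * u)))))) (at u)" for u
      by (rule DERIV_cong[OF DERIV_mult[OF DERIV_mult[OF deriv_sin_turn deriv_cos_turn]
            DERIV_chain2[OF d DERIV_cmult[OF deriv_cos_turn]]]])
         (simp add: algebra_simps power2_eq_square[symmetric] cos_squared_eq)
  qed simp
  from has_integral_divide[OF this, of "2 * pi"]
  have *: "((\<lambda>u. (sin (2 * pi * u) ^ 0 * \<phi> (R * cos (2 * pi * u)) - 2 * (sin (2 * pi * u) ^ 2 * \<phi>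
      (R * cos (2 * pi * u))))
       - R * (sin (2 * pi * u) ^ 2 * (cos (2 * pi * u) * \<phi>' (R * cos (2 * pi * u))))) has_integral
       0) {0..1}"
    by simp
  have "((\<lambda>u. sin (2 * pi * u) ^ 0 * \<phi> (R * cos (2 * pi * u)) - 2 * (sin (2 * pi * u) ^ 2 * \<phi> (R *
      cos (2 * pi * u))))
    has_integral circle_average 0 \<phi> R - 2 * circle_average 2 \<phi> R) {0..1}"
    by (intro has_integral_diff has_integral_mult_right has_integral_circle_average c0)
  from has_integral_diff[OF this *] show ?thesis by simp
qed

lemma continuous_on_circle_average:
  fixes \<phi> :: "'p::topological_space \<Rightarrow> real \<Rightarrow> real" and r :: "'s::t2_space \<Rightarrow> real"
  assumes "continuous_on UNIV (\<lambda>(p, x). \<phi> p x)" "continuous_on S r" "continuous_on S q"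
  shows "continuous_on S (\<lambda>s. circle_average k (\<phi> (q s)) (r s))"
proof -
  have "continuous_on (S \<times> cbox 0 1) (\<lambda>(s, u). sin (2 * pi * u) ^ k * \<phi> (q s) (r s * cos (2 * pi * u)))"
  proof -
    have "continuous_on (S \<times> cbox 0 (1::real)) (\<lambda>z. (\<lambda>(p, x). \<phi> p x) (q (fst z), r (fst z) * cos
        (2 * pi * snd z)))"
      by (rule continuous_on_compose2[OF assms(1)])
         (auto intro!: continuous_intros continuous_on_compose2[OF assms(2)]
             continuous_on_compose2[OF assms(3)])
    then show ?thesis by (auto intro!: continuous_intros simp: case_prod_beta)
  qed
  from integral_continuous_on_param[OF this] show ?thesis
    unfolding circle_average_def by simp
qed

lemma circle_average_deriv_parameter:
  fixes \<phi> :: "real \<Rightarrow> real \<Rightarrow> real"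
  assumes "continuous_on UNIV (\<lambda>(p, x). \<phi> p x)" "continuous_on UNIV (\<lambda>(p, x). \<phi>' p x)"
    and "\<And>p x. ((\<lambda>p. \<phi> p x) has_real_derivative \<phi>' p x) (at p)"
  shows "((\<lambda>p. circle_average k (\<phi> p) R) has_real_derivative circle_average k (\<phi>' p) R) (at p)"
proof -
  have "((\<lambda>p. integral (cbox 0 1) (\<lambda>u. sin (2 * pi * u) ^ k * \<phi> p (R * cos (2 * pi * u))))
      has_field_derivative
      integral (cbox 0 1) (\<lambda>u. sin (2 * pi * u) ^ k * \<phi>' p (R * cos (2 * pi * u)))) (at p within UNIV)"
  proof (rule leibniz_rule_field_derivative)
    fix p :: real
    have "continuous_on UNIV (\<phi> p)"
      using continuous_on_compose2[OF assms(1), of UNIV "\<lambda>x. (p, x)"]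
        continuous_on_Pair[of UNIV "\<lambda>_. p" "\<lambda>x. x"] by auto
    from has_integral_circle_average[OF this, of k R]
    show "(\<lambda>u. sin (2 * pi * u) ^ k * \<phi> p (R * cos (2 * pi * u))) integrable_on cbox 0 1"
      by (auto simp: integrable_on_def)
  next
    have "continuous_on (UNIV \<times> cbox 0 (1::real)) (\<lambda>z. (\<lambda>(p, x). \<phi>' p x) (fst z, R * cos (2 * pi *
        snd z)))"
      by (rule continuous_on_compose2[OF assms(2)]) (auto intro!: continuous_intros)
    then show "continuous_on (UNIV \<times> cbox 0 1) (\<lambda>(p, u). sin (2 * pi * u) ^ k * \<phi>' p (R * cos (2 *
        pi * u)))"
      by (auto intro!: continuous_intros simp: case_prod_beta)
  qed (auto intro!: derivative_eq_intros assms(3))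
  then show ?thesis unfolding circle_average_def by simp
qed

lemma circle_average_deriv_radius:
  assumes d: "\<And>x. (\<phi> has_real_derivative \<phi>' x) (at x)" and c: "continuous_on UNIV \<phi>'"
  shows "(circle_average k \<phi> has_real_derivative
    integral {0..1} (\<lambda>u. sin (2 * pi * u) ^ k * (cos (2 * pi * u) * \<phi>' (R * cos (2 * pi * u))))) (at R)"
proof -
  have c0: "continuous_on UNIV \<phi>" using d by (meson DERIV_isCont continuous_at_imp_continuous_on)
  have "((\<lambda>R. integral (cbox 0 1) (\<lambda>u. sin (2 * pi * u) ^ k * \<phi> (R * cos (2 * pi * u))))
      has_field_derivative
      integral (cbox 0 1) (\<lambda>u. sin (2 * pi * u) ^ k * (cos (2 * pi * u) * \<phi>' (R * cos (2 * pi *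
      u))))) (at R within UNIV)"
  proof (rule leibniz_rule_field_derivative)
    show "(\<lambda>u. sin (2 * pi * u) ^ k * \<phi> (R * cos (2 * pi * u))) integrable_on cbox 0 1" for R
      using has_integral_circle_average[OF c0, of k R] by (auto simp: integrable_on_def)
    have "continuous_on (UNIV \<times> cbox 0 (1::real)) (\<lambda>z. \<phi>' (fst z * cos (2 * pi * snd z)))"
      by (rule continuous_on_compose2[OF c]) (auto intro!: continuous_intros)
    then show "continuous_on (UNIV \<times> cbox 0 1) (\<lambda>(R, u). sin (2 * pi * u) ^ k * (cos (2 * pi * u)
        * \<phi>' (R * cos (2 * pi * u))))"
      by (auto intro!: continuous_intros simp: case_prod_beta)
  qed (auto intro!: derivative_eq_intros DERIV_chain2[OF d])
  then show ?thesis unfolding circle_average_def[abs_def] by simp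
qed

text \<open>
  The factor \<open>1 / sqrt t\<close> from the chain rule is singular at \<open>t = 0\<close>. Integration by parts
  cancels it at the cost of one more derivative of \<open>\<phi>\<close>, and the right-hand side is continuous up
  to \<open>t = 0\<close>.
\<close>

lemma circle_average_deriv_sqrt:
  assumes d: "\<And>x. (\<phi> has_real_derivative \<phi>' x) (at x)" "\<And>x. (\<phi>' has_real_derivative \<phi>'' x) (at x)"
    and c: "continuous_on UNIV \<phi>''" and t: "t > 0"
  shows "((\<lambda>t. circle_average k \<phi> (sqrt t)) has_real_derivative
    circle_average (k + 2) \<phi>'' (sqrt t) / (2 * real (k + 1))) (at t)"
proof -
  have c0: "continuous_on UNIV \<phi>'" using d by (meson DERIV_isCont continuous_at_imp_continuous_on)
  have "((\<lambda>t. circle_average k \<phi> (sqrt t)) has_real_derivative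
    (sqrt t * circle_average (k + 2) \<phi>'' (sqrt t) / real (k + 1)) * (inverse (sqrt t) / 2)) (at t)"
    using circle_average_deriv_radius[OF d(1) c0, of k "sqrt t"]
    unfolding integral_unique[OF circle_average_by_parts[OF d(2) c, of k "sqrt t"]]
    by (rule DERIV_chain2) (rule DERIV_real_sqrt[OF t])
  with t show ?thesis by (simp add: field_simps)
qed

text \<open>
  The derivative of the action in the energy, which is the period up to a constant factor; in
  this form its positivity is evident.
\<close>

lemma action_deriv_energy:
  assumes d: "\<And>x. (\<phi> has_real_derivative \<phi>' x) (at x)" and c: "continuous_on UNIV \<phi>'" and t: "t > 0"
  shows "((\<lambda>t. t * circle_average 2 \<phi> (sqrt t)) has_real_derivative
    circle_average 0 \<phi> (sqrt t) / 2) (at t)"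
proof -
  define I where "I = integral {0..1} (\<lambda>u. sin (2 * pi * u) ^ 2 * (cos (2 * pi * u) * \<phi>' (sqrt t *
      cos (2 * pi * u))))"
  have I: "sqrt t * I = circle_average 0 \<phi> (sqrt t) - 2 * circle_average 2 \<phi> (sqrt t)"
    using integral_unique[OF circle_average_by_parts_base[OF d c, of "sqrt t"]] by (simp add: I_def)
  have "((\<lambda>t. circle_average 2 \<phi> (sqrt t)) has_real_derivative I * (inverse (sqrt t) / 2)) (at t)"
    unfolding I_def by (rule DERIV_chain2[OF circle_average_deriv_radius[OF d c] DERIV_real_sqrt[OF t]])
  then have "((\<lambda>t. t * circle_average 2 \<phi> (sqrt t)) has_real_derivative
      circle_average 2 \<phi> (sqrt t) + t * (I * (inverse (sqrt t) / 2))) (at t)"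
    by (auto intro!: derivative_eq_intros)
  moreover have "circle_average 2 \<phi> (sqrt t) + t * (I * (inverse (sqrt t) / 2)) = circle_average 0
      \<phi> (sqrt t) / 2"
  proof -
    have "t * inverse (sqrt t) = sqrt t" using t by (simp add: real_div_sqrt flip: divide_inverse)
    then have "t * (I * (inverse (sqrt t) / 2)) = sqrt t * I / 2"
      by (metis (no_types, opaque_lifting) mult.left_commute mult.commute times_divide_eq_right)
    with I show ?thesis by linarith
  qed
  ultimately show ?thesis by (rule DERIV_cong)
qed

lemma circle_average_0_radius: "circle_average k \<phi> 0 = circle_average k (\<lambda>_. 1) 0 * \<phi> 0"
  by (simp add: circle_average_def)

lemma circle_average_moments:
  "circle_average 0 (\<lambda>_. 1) R = 1" "circle_average 2 (\<lambda>_. 1) R = 1/2" "circle_average 4 (\<lambda>_. 1) R = 3/8"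
proof -
  have c1: "continuous_on UNIV (\<lambda>_::real. 1::real)" by simp
  show 0: "circle_average 0 (\<lambda>_. 1) R = 1" for R by (simp add: circle_average_def)
  have step: "real (k + 2) * circle_average (k + 2) (\<lambda>_. 1) R = real (k + 1) * circle_average k
      (\<lambda>_. 1) R" for k R
  proof -
    have lhs: "((\<lambda>u. sin (2 * pi * u) ^ k * (cos (2 * pi * u) * (1 * cos (2 * pi * u)))) has_integral
       1 * circle_average (k + 2) (\<lambda>_. 1) 1 / real (k + 1)) {0..1}"
      by (rule circle_average_by_parts) (auto intro!: derivative_eq_intros)
    have rhs: "((\<lambda>u. sin (2 * pi * u) ^ k * 1 - sin (2 * pi * u) ^ (k + 2) * 1) has_integral
       circle_average k (\<lambda>_. 1) 1 - circle_average (k + 2) (\<lambda>_. 1) 1) {0..1}"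
      by (intro has_integral_diff has_integral_circle_average[OF c1])
    have eq: "(\<lambda>u. sin (2 * pi * u) ^ k * (cos (2 * pi * u) * (1 * cos (2 * pi * u)))) =
      (\<lambda>u. sin (2 * pi * u) ^ k * 1 - sin (2 * pi * u) ^ (k + 2) * 1)"
    proof
      fix u
      have "cos (2 * pi * u) * (1 * cos (2 * pi * u)) = 1 - sin (2 * pi * u) ^ 2"
        by (simp add: cos_squared_eq flip: power2_eq_square)
      then show "sin (2 * pi * u) ^ k * (cos (2 * pi * u) * (1 * cos (2 * pi * u))) =
          sin (2 * pi * u) ^ k * 1 - sin (2 * pi * u) ^ (k + 2) * 1"
        by (simp only: power_add right_diff_distrib)
    qed
    have "circle_average (k + 2) (\<lambda>_. 1) 1 / real (k + 1) =
       circle_average k (\<lambda>_. 1) 1 - circle_average (k + 2) (\<lambda>_. 1) 1"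
      using has_integral_unique[OF lhs rhs[folded eq]] by simp
    then have "real (k + 2) * circle_average (k + 2) (\<lambda>_. 1) 1 = real (k + 1) * circle_average k
        (\<lambda>_. 1) 1"
      by (simp add: field_simps)
    then show ?thesis by (simp add: circle_average_def)
  qed
  show 2: "circle_average 2 (\<lambda>_. 1) R = 1/2" for R using step[of 0 R] 0 by (simp add: numeral_2_eq_2)
  show "circle_average 4 (\<lambda>_. 1) R = 3/8" using step[of 2 R] 2 by simp
qed

lemma circle_average_pos:
  assumes "continuous_on UNIV \<phi>" "\<And>x. \<phi> x > 0"
  shows "circle_average 0 \<phi> R > 0"
proof -
  have "integral {0..1::real} (\<lambda>u. 0) < integral {0..1} (\<lambda>u. \<phi> (R * cos (2 * pi * u)))"
  proof (rule integral_less_real)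
    show "continuous_on {0..1} (\<lambda>u. \<phi> (R * cos (2 * pi * u)))"
      by (auto intro!: continuous_intros continuous_on_compose2[OF assms(1)])
  qed (use assms(2) in auto)
  then show ?thesis by (simp add: circle_average_def)
qed

section \<open>The action as a function of energy and size\<close>

text \<open>
  \<open>G 0\<close> is the function \<open>G\<close> that encodes the inverse mass, and \<open>G i\<close> its \<open>i\<close>-th derivative.
\<close>

locale oscillator =
  fixes G :: "nat \<Rightarrow> real \<Rightarrow> real"
  assumes G_deriv: "i < 4 \<Longrightarrow> (G i has_real_derivative G (Suc i) x) (at x)"
    and G4_cont: "continuous_on UNIV (G 4)"
    and G_pos: "G 0 x > 0"
begin

lemma G_cont: "i \<le> 4 \<Longrightarrow> continuous_on UNIV (G i)"
  using G_deriv[of i] G4_cont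
  by (cases "i = 4") (auto intro!: continuous_at_imp_continuous_on intro: DERIV_isCont)

text \<open>
  The integrand \<open>G (L + y x) * y' x\<close> of the action, with \<open>G\<close> replaced by its \<open>j\<close>-th derivative,
  and below its first four derivatives in \<open>x\<close>. A derivative in \<open>L\<close> only raises \<open>j\<close>.
\<close>

definition weight :: "nat \<Rightarrow> real \<Rightarrow> real \<Rightarrow> real" where
  "weight j L x = G j (L + displacement x) * disp_deriv 1 x"

definition weight1 :: "nat \<Rightarrow> real \<Rightarrow> real \<Rightarrow> real" where
  "weight1 j L x = G (j + 1) (L + displacement x) * disp_deriv 1 x ^ 2 + G j (L + displacement x)
      * disp_deriv 2 x"

definition weight2 :: "nat \<Rightarrow> real \<Rightarrow> real \<Rightarrow> real" where
  "weight2 j L x = G (j + 2) (L + displacement x) * disp_deriv 1 x ^ 3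
     + 3 * G (j + 1) (L + displacement x) * disp_deriv 1 x * disp_deriv 2 x
     + G j (L + displacement x) * disp_deriv 3 x"

definition weight3 :: "nat \<Rightarrow> real \<Rightarrow> real \<Rightarrow> real" where
  "weight3 j L x = G (j + 3) (L + displacement x) * disp_deriv 1 x ^ 4
     + 6 * G (j + 2) (L + displacement x) * disp_deriv 1 x ^ 2 * disp_deriv 2 x
     + G (j + 1) (L + displacement x) * (3 * disp_deriv 2 x ^ 2 + 4 * disp_deriv 1 x * disp_deriv 3 x)
     + G j (L + displacement x) * disp_deriv 4 x"

definition weight4 :: "nat \<Rightarrow> real \<Rightarrow> real \<Rightarrow> real" where
  "weight4 j L x = G (j + 4) (L + displacement x) * disp_deriv 1 x ^ 5
     + 10 * G (j + 3) (L + displacement x) * disp_deriv 1 x ^ 3 * disp_deriv 2 x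
     + G (j + 2) (L + displacement x) * (15 * disp_deriv 1 x * disp_deriv 2 x ^ 2 + 10 *
     disp_deriv 1 x ^ 2 * disp_deriv 3 x)
     + G (j + 1) (L + displacement x) * (10 * disp_deriv 2 x * disp_deriv 3 x + 5 * disp_deriv 1 x
     * disp_deriv 4 x)
     + G j (L + displacement x) * disp_deriv 5 x"

lemma G_comp_deriv:
  assumes "i < 4"
  shows "((\<lambda>x. G i (L + displacement x)) has_real_derivative G (Suc i) (L + displacement x) *
      disp_deriv 1 x) (at x)"
proof (rule DERIV_chain2[of "G i"])
  show "((\<lambda>x. L + displacement x) has_real_derivative disp_deriv 1 x) (at x)"
    using disp_deriv_DERIV[of 0 x] unfolding disp_deriv_0 by (auto intro!: derivative_eq_intros)
qed (rule G_deriv[OF assms])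

lemmas weight_derivs = derivative_eq_intros G_comp_deriv disp_deriv_DERIV

lemma weight_deriv: "j < 4 \<Longrightarrow> (weight j L has_real_derivative weight1 j L x) (at x)"
  unfolding weight_def[abs_def] weight1_def
  by (auto intro!: weight_derivs simp: numeral_eq_Suc algebra_simps)

lemma weight1_deriv: "j < 3 \<Longrightarrow> (weight1 j L has_real_derivative weight2 j L x) (at x)"
  unfolding weight1_def[abs_def] weight2_def
  by (auto intro!: weight_derivs simp: numeral_eq_Suc algebra_simps)

lemma weight2_deriv: "j < 2 \<Longrightarrow> (weight2 j L has_real_derivative weight3 j L x) (at x)"
  unfolding weight2_def[abs_def] weight3_def
  by (auto intro!: weight_derivs simp: numeral_eq_Suc algebra_simps)

lemma weight3_deriv: "j < 1 \<Longrightarrow> (weight3 j L has_real_derivative weight4 j L x) (at x)"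
  unfolding weight3_def[abs_def] weight4_def
  by (auto intro!: weight_derivs simp: numeral_eq_Suc algebra_simps)

lemma G_comp_cont:
  assumes "i \<le> 4" shows "continuous_on UNIV (\<lambda>z. G i (fst z + displacement (snd z)))"
  using continuous_disp_deriv[of 0] unfolding disp_deriv_0
  by (auto intro!: continuous_intros continuous_on_compose2[OF G_cont[OF assms]]
      continuous_on_compose2[of UNIV displacement])

lemma weight_cont:
  "j \<le> 4 \<Longrightarrow> continuous_on UNIV (\<lambda>(L, x). weight j L x)"
  "j \<le> 2 \<Longrightarrow> continuous_on UNIV (\<lambda>(L, x). weight2 j L x)"
  "j = 0 \<Longrightarrow> continuous_on UNIV (\<lambda>(L, x). weight4 j L x)"
  unfolding weight_def weight2_def weight4_def case_prod_beta
  by (auto intro!: continuous_intros G_comp_cont continuous_on_compose2[OF continuous_disp_deriv])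

lemma continuous_on_section: "continuous_on UNIV (\<lambda>(p, x). f p x) \<Longrightarrow> continuous_on UNIV (f p)"
  for f :: "real \<Rightarrow> real \<Rightarrow> real"
  using continuous_on_compose2[of UNIV "\<lambda>(p, x). f p x" UNIV "\<lambda>x. (p, x)"]
    continuous_on_Pair[of UNIV "\<lambda>_. p" "\<lambda>x. x"] by auto

lemma G_shift_deriv:
  "i < 4 \<Longrightarrow> ((\<lambda>L. G i (L + c)) has_real_derivative G (Suc i) (L + c)) (at L)"
  using G_deriv[of i "L + c"] by (simp add: DERIV_shift)

lemma weight_deriv_L:
  "j < 4 \<Longrightarrow> ((\<lambda>L. weight j L x) has_real_derivative weight (Suc j) L x) (at L)"
  "j < 2 \<Longrightarrow> ((\<lambda>L. weight2 j L x) has_real_derivative weight2 (Suc j) L x) (at L)"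
  unfolding weight_def weight2_def
  by (auto intro!: derivative_eq_intros G_shift_deriv simp: numeral_eq_Suc algebra_simps)

text \<open>
  The \<open>j\<close>-th derivative in \<open>L\<close> of the action \<open>a(t, L)\<close> and of its first three \<open>t\<close>-derivatives.
  These formulas are continuous up to \<open>t = 0\<close>, although the differentiation is carried out for
  \<open>t > 0\<close> only.
\<close>

definition act :: "nat \<Rightarrow> real \<Rightarrow> real \<Rightarrow> real" where
  "act j t L = t * circle_average 2 (weight j L) (sqrt t)"

definition act_t :: "nat \<Rightarrow> real \<Rightarrow> real \<Rightarrow> real" where
  "act_t j t L = circle_average 0 (weight j L) (sqrt t) / 2"

definition act_tt :: "nat \<Rightarrow> real \<Rightarrow> real \<Rightarrow> real" where
  "act_tt j t L = circle_average 2 (weight2 j L) (sqrt t) / 4"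

definition act_ttt :: "nat \<Rightarrow> real \<Rightarrow> real \<Rightarrow> real" where
  "act_ttt j t L = circle_average 4 (weight4 j L) (sqrt t) / 24"

lemma act_deriv_t: "j < 4 \<Longrightarrow> t > 0 \<Longrightarrow> ((\<lambda>t. act j t L) has_real_derivative act_t j t L) (at t)"
  unfolding act_def act_t_def
proof (rule action_deriv_energy)
  assume j: "j < 4"
  then show "(weight j L has_real_derivative weight1 j L x) (at x)" for x by (rule weight_deriv)
  show "continuous_on UNIV (weight1 j L)"
    using j unfolding weight1_def[abs_def]
    by (auto intro!: continuous_intros continuous_on_compose2[OF continuous_disp_deriv]
        continuous_on_section[of "\<lambda>L x. G j (L + displacement x)"]
        continuous_on_section[of "\<lambda>L x. G (Suc j) (L + displacement x)"] G_comp_cont simp: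
        case_prod_beta)
qed

lemma act_t_deriv_t:
  assumes "j < 3" "t > 0"
  shows "((\<lambda>t. act_t j t L) has_real_derivative act_tt j t L) (at t)"
proof -
  have "((\<lambda>t. circle_average 0 (weight j L) (sqrt t)) has_real_derivative
    circle_average (0 + 2) (weight2 j L) (sqrt t) / (2 * real (0 + 1))) (at t)"
    using assms
    by (intro circle_average_deriv_sqrt[OF weight_deriv weight1_deriv] continuous_on_section
        weight_cont) auto
  from DERIV_cdivide[OF this, of 2] show ?thesis by (simp add: act_t_def act_tt_def numeral_2_eq_2)
qed

lemma act_tt_deriv_t:
  assumes "t > 0"
  shows "((\<lambda>t. act_tt 0 t L) has_real_derivative act_ttt 0 t L) (at t)"
proof -
  have "((\<lambda>t. circle_average 2 (weight2 0 L) (sqrt t)) has_real_derivative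
    circle_average (2 + 2) (weight4 0 L) (sqrt t) / (2 * real (2 + 1))) (at t)"
    using assms
    by (intro circle_average_deriv_sqrt[OF weight2_deriv weight3_deriv] continuous_on_section
        weight_cont) auto
  from DERIV_cdivide[OF this, of 4] show ?thesis by (simp add: act_tt_def act_ttt_def)
qed

lemma act_deriv_L:
  "j < 4 \<Longrightarrow> ((\<lambda>L. act j t L) has_real_derivative act (Suc j) t L) (at L)"
  "j < 4 \<Longrightarrow> ((\<lambda>L. act_t j t L) has_real_derivative act_t (Suc j) t L) (at L)"
  "j < 2 \<Longrightarrow> ((\<lambda>L. act_tt j t L) has_real_derivative act_tt (Suc j) t L) (at L)"
  unfolding act_def act_t_def act_tt_def
  by (auto intro!: DERIV_cmult DERIV_cdivide circle_average_deriv_parameter weight_cont weight_deriv_L)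

lemma continuous_on_act:
  fixes r q :: "'s::t2_space \<Rightarrow> real"
  assumes "continuous_on S r" "continuous_on S q"
  shows "j \<le> 4 \<Longrightarrow> continuous_on S (\<lambda>s. act j (r s) (q s))"
    "j \<le> 4 \<Longrightarrow> continuous_on S (\<lambda>s. act_t j (r s) (q s))"
    "j \<le> 2 \<Longrightarrow> continuous_on S (\<lambda>s. act_tt j (r s) (q s))"
    "j = 0 \<Longrightarrow> continuous_on S (\<lambda>s. act_ttt j (r s) (q s))"
  unfolding act_def act_t_def act_tt_def act_ttt_def
  by (intro continuous_intros continuous_on_circle_average weight_cont assms; simp)+

text \<open>
  On the circle of radius \<open>0\<close> the means are moments of \<open>sin\<close> times values at the bottom of the
  well, so the Taylor coefficients of \<open>displacement\<close> appear here.
\<close>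

lemma act_at_0:
  "act j 0 L = 0"
  "act_t j 0 L = G j L / 2"
  "act_tt j 0 L = (G (j + 2) L + 2 * G (j + 1) L + 2/3 * G j L) / 8"
  "act_ttt 0 0 L = (G 4 L + 20/3 * G 3 L + 40/3 * G 2 L + 8 * G 1 L + 4/9 * G 0 L) / 64"
  unfolding act_def act_t_def act_tt_def act_ttt_def real_sqrt_zero
  by (simp_all add: circle_average_0_radius[of _ "weight _ _"] circle_average_0_radius[of _
      "weight2 _ _"]
      circle_average_0_radius[of _ "weight4 _ _"] circle_average_moments weight_def weight2_def
      weight4_def
      displacement_Taylor displacement_Taylor(1)[simplified] power2_eq_square field_simps)
    (simp add: numeral_2_eq_2)

lemma act_t_pos: "act_t 0 t L > 0"
  unfolding act_t_def using G_pos disp_deriv_1_pos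
  by (auto intro!: circle_average_pos continuous_on_section[OF weight_cont(1)] simp: weight_def)

section \<open>The two determinants near the equilibria\<close>

text \<open>
  In the coordinates energy (divided by \<open>c\<close>) and \<open>L\<close>, the size derivative at fixed energy is \<open>X
  = \<partial>\<^sub>L - \<partial>\<^sub>t\<close>. Then \<open>iso_det\<close> is \<open>X\<^sup>2 a - X a\<close>, the second derivative of the action in \<open>\<rho>\<close> at
  fixed energy up to a positive factor, and \<open>kol_det\<close> is, up to a positive factor, the Hessian
  determinant of the action as a function of energy and \<open>\<rho>\<close>.
\<close>

definition iso_det :: "real \<Rightarrow> real \<Rightarrow> real" where
  "iso_det t L = act 2 t L - 2 * act_t 1 t L + act_tt 0 t L - act 1 t L + act_t 0 t L"

definition iso_det_t :: "real \<Rightarrow> real \<Rightarrow> real" where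
  "iso_det_t t L = act_t 2 t L - 2 * act_tt 1 t L + act_ttt 0 t L - act_t 1 t L + act_tt 0 t L"

definition kol_det :: "real \<Rightarrow> real \<Rightarrow> real" where
  "kol_det t L = act_tt 0 t L * (act 2 t L - act 1 t L + act_t 0 t L) - (act_t 1 t L)\<^sup>2"

definition kol_det_t :: "real \<Rightarrow> real \<Rightarrow> real" where
  "kol_det_t t L = act_ttt 0 t L * (act 2 t L - act 1 t L + act_t 0 t L)
     + act_tt 0 t L * (act_t 2 t L - act_t 1 t L + act_tt 0 t L) - 2 * act_t 1 t L * act_tt 1 t L"

lemma iso_det_deriv: "t > 0 \<Longrightarrow> ((\<lambda>t. iso_det t L) has_real_derivative iso_det_t t L) (at t)"
  unfolding iso_det_def iso_det_t_def
  by (auto intro!: derivative_eq_intros act_deriv_t act_t_deriv_t act_tt_deriv_t)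

lemma kol_det_deriv: "t > 0 \<Longrightarrow> ((\<lambda>t. kol_det t L) has_real_derivative kol_det_t t L) (at t)"
  unfolding kol_det_def kol_det_t_def
  by (auto intro!: derivative_eq_intros act_deriv_t act_t_deriv_t act_tt_deriv_t simp: algebra_simps)

lemma continuous_on_dets:
  fixes r q :: "'s::t2_space \<Rightarrow> real"
  assumes "continuous_on S r" "continuous_on S q"
  shows "continuous_on S (\<lambda>s. iso_det (r s) (q s))" "continuous_on S (\<lambda>s. iso_det_t (r s) (q s))"
    "continuous_on S (\<lambda>s. kol_det (r s) (q s))" "continuous_on S (\<lambda>s. kol_det_t (r s) (q s))"
  unfolding iso_det_def iso_det_t_def kol_det_def kol_det_t_def
  by (intro continuous_intros continuous_on_act assms; simp)+

lemma deriv_eq_on_open: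
  fixes f g :: "real \<Rightarrow> real"
  assumes "open S" "L \<in> S" "\<And>L. L \<in> S \<Longrightarrow> f L = g L"
    "(f has_real_derivative f') (at L)" "(g has_real_derivative g') (at L)"
  shows "f' = g'"
proof -
  have "(g has_real_derivative f') (at L)"
    using assms(4,1,2,3) by (rule has_field_derivative_transform_within_open)
  then show ?thesis using assms(5) by (rule DERIV_unique)
qed

lemma G_derivs:
  "(G 0 has_real_derivative G 1 x) (at x)" "(G 1 has_real_derivative G 2 x) (at x)"
  "(G 2 has_real_derivative G 3 x) (at x)" "(G 3 has_real_derivative G 4 x) (at x)"
  using G_deriv[of 0 x] G_deriv[of 1 x] G_deriv[of 2 x] G_deriv[of 3 x] by (simp_all add:
      numeral_2_eq_2[symmetric])

text \<open>
  The vanishing of \<open>iso_det\<close> at \<open>t = 0\<close> is a linear differential equation of second order for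
  \<open>G\<close>, by which all higher derivatives in \<open>iso_det_t\<close> can be eliminated. What remains is of
  first order and incompatible with the equation.
\<close>

lemma iso_det_jet_nonzero:
  assumes "open S" "S \<noteq> {}"
  shows "\<exists>L\<in>S. iso_det 0 L \<noteq> 0 \<or> iso_det_t 0 L \<noteq> 0"
proof (rule ccontr)
  assume "\<not> ?thesis"
  then have z: "iso_det 0 L = 0" "iso_det_t 0 L = 0" if "L \<in> S" for L using that by auto
  note eqD = deriv_eq_on_open[OF assms(1)]
  note di = derivative_eq_intros G_derivs G_derivs[simplified]
  have g2: "G 2 L = 6 * G 1 L - 14/3 * G 0 L" if "L \<in> S" for L
    using z(1)[OF that] by (simp add: iso_det_def act_at_0 numeral_2_eq_2[symmetric] field_simps)
  have g3: "G 3 L = 6 * G 2 L - 14/3 * G 1 L" if "L \<in> S" for L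
    by (rule eqD[OF that g2]) (auto intro!: di)
  have g4: "G 4 L = 6 * G 3 L - 14/3 * G 2 L" if "L \<in> S" for L
    by (rule eqD[OF that g3]) (auto intro!: di)
  have r: "13 * G 1 L = 12 * G 0 L" if "L \<in> S" for L
    using z(2)[OF that] g4[OF that] g3[OF that] g2[OF that]
    by (simp add: iso_det_t_def act_at_0 numeral_2_eq_2[symmetric] numeral_3_eq_3[symmetric]
        field_simps)
  obtain L where L: "L \<in> S" using assms(2) by auto
  have "13 * G 2 L = 12 * G 1 L"
    by (rule eqD[OF L r]) (auto intro!: di)
  with r[OF L] g2[OF L] G_pos[of L] show False by simp
qed

text \<open>
  The vanishing of \<open>kol_det\<close> at \<open>t = 0\<close> is a homogeneous quadratic differential equation for
  \<open>G\<close>, hence an autonomous first-order equation for \<open>l = G' / G\<close>. After elimination \<open>kol_det_t\<close>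
  is \<open>G\<^sup>2\<close> times a quartic polynomial in \<open>l\<close>, which has no double root and no common root with
  the right-hand side of the equation for \<open>l\<close>.
\<close>

lemma kol_det_jet_nonzero:
  assumes "open S" "S \<noteq> {}"
  shows "\<exists>L\<in>S. kol_det 0 L \<noteq> 0 \<or> kol_det_t 0 L \<noteq> 0"
proof (rule ccontr)
  assume "\<not> ?thesis"
  then have z: "kol_det 0 L = 0" "kol_det_t 0 L = 0" if "L \<in> S" for L using that by auto
  note eqD = deriv_eq_on_open[OF assms(1)]
  have pos: "G 0 L \<noteq> 0" for L using G_pos[of L] by simp
  define l where "l L = G 1 L / G 0 L" for L
  have g1: "G 1 L = G 0 L * l L" for L using pos by (simp add: l_def)
  have g2: "G 2 L = G 0 L * (4 * l L ^ 2 - 2 * l L - 2/3)" if "L \<in> S" for L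
  proof -
    have "G 0 L * (G 2 L + 2 * G 1 L + 2/3 * G 0 L) = 4 * (G 1 L)\<^sup>2"
      using z(1)[OF that] by (simp add: kol_det_def act_at_0 numeral_2_eq_2[symmetric] field_simps
          power2_eq_square)
    then have "G 0 L * (G 2 L - G 0 L * (4 * l L ^ 2 - 2 * l L - 2/3)) = 0"
      unfolding g1 by (simp add: algebra_simps power2_eq_square)
    with pos[of L] show ?thesis by simp
  qed
  \<comment> \<open>The Riccati equation; its right-hand side is \<open>G'' / G - l\<^sup>2\<close>.\<close>
  have dl: "(l has_real_derivative 3 * l L ^ 2 - 2 * l L - 2/3) (at L)" if "L \<in> S" for L
  proof -
    have "(l has_real_derivative (G 2 L * G 0 L - G 1 L * G 1 L) / (G 0 L * G 0 L)) (at L)"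
      unfolding l_def[abs_def] by (rule DERIV_divide[OF G_derivs(2,1) pos])
    moreover have "(G 2 L * G 0 L - G 1 L * G 1 L) / (G 0 L * G 0 L) = 3 * l L ^ 2 - 2 * l L - 2/3"
      unfolding g1 g2[OF that] using pos[of L] by (simp add: field_simps power2_eq_square)
    ultimately show ?thesis by simp
  qed
  have g3: "G 3 L = G 0 L * (28 * l L ^ 3 - 24 * l L ^ 2 - 2 * l L + 4/3)" if L: "L \<in> S" for L
    by (rule eqD[OF L g2 G_derivs(3)]) (auto intro!: derivative_eq_intros G_derivs(1) dl[OF L]
        simp: g1[simplified] algebra_simps power2_eq_square power3_eq_cube)
  have g4: "G 4 L = G 0 L * (280 * l L ^ 4 - 336 * l L ^ 3 + 32 * l L ^ 2 + 112/3 * l L + 4/3)" if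
      L: "L \<in> S" for L
    by (rule eqD[OF L g3 G_derivs(4)]) (auto intro!: derivative_eq_intros G_derivs(1) dl[OF L]
        simp: g1[simplified] algebra_simps power2_eq_square power3_eq_cube power4_eq_xxxx)
  have r: "2 + 6 * l L - 12 * l L ^ 2 + 12 * l L ^ 3 - 9 * l L ^ 4 = 0" if "L \<in> S" for L
  proof -
    have "kol_det_t 0 L = (G 0 L)\<^sup>2 * (2 + 6 * l L - 12 * l L ^ 2 + 12 * l L ^ 3 - 9 * l L ^ 4) / 144"
      by (simp add: kol_det_t_def act_at_0 numeral_2_eq_2[symmetric] numeral_3_eq_3[symmetric])
         (simp add: g1[simplified] g2[OF that] g3[OF that] g4[OF that] field_simps
             power2_eq_square power3_eq_cube power4_eq_xxxx)
    with z(2)[OF that] pos[of L] show ?thesis by simp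
  qed
  \<comment> \<open>Differentiating the quartic along the Riccati equation leaves two cases, and in each of them
     reduction of the quartic determines its root, which is not a root of the other factor.\<close>
  obtain L where L: "L \<in> S" using assms(2) by auto
  define a where "a = l L"
  have r0: "2 + 6 * a - 12 * a ^ 2 + 12 * a ^ 3 - 9 * a ^ 4 = 0" unfolding a_def by (rule r[OF L])
  have "(6 - 24 * a + 36 * a ^ 2 - 36 * a ^ 3) * (3 * a ^ 2 - 2 * a - 2/3) = 0"
    unfolding a_def by (rule eqD[OF L r]) (auto intro!: derivative_eq_intros dl[OF L] simp:
        algebra_simps)
  then have "9 * a ^ 2 = 6 * a + 2 \<or> 6 * a ^ 3 = 6 * a ^ 2 - 4 * a + 1"
    unfolding mult_eq_0_iff by linarith
  then consider "9 * a ^ 2 = 6 * a + 2" | "6 * a ^ 3 = 6 * a ^ 2 - 4 * a + 1" by blast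
  then show False
  proof cases
    case 1
    then have "a * (9 * a ^ 2) = a * (6 * a + 2)" "a ^ 2 * (9 * a ^ 2) = a ^ 2 * (6 * a + 2)" by
        simp_all
    then have "9 * a ^ 3 = 6 * a ^ 2 + 2 * a" "9 * a ^ 4 = 6 * a ^ 3 + 2 * a ^ 2"
      by (simp_all add: algebra_simps power2_eq_square power3_eq_cube power4_eq_xxxx)
    with r0 1 have "a = 1 / 3" by linarith
    with 1 show False by (simp add: power2_eq_square)
  next
    case 2
    then have "a * (6 * a ^ 3) = a * (6 * a ^ 2 - 4 * a + 1)" by simp
    then have "6 * a ^ 4 = 6 * a ^ 3 - 4 * a ^ 2 + a"
      by (simp add: algebra_simps power2_eq_square power3_eq_cube power4_eq_xxxx)
    with r0 2 have q: "6 * a ^ 2 = 5 * a + 5" by linarith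
    then have "a * (6 * a ^ 2) = a * (5 * a + 5)" by simp
    then have "6 * a ^ 3 = 5 * a ^ 2 + 5 * a"
      by (simp add: algebra_simps power2_eq_square power3_eq_cube)
    with q 2 have "a = 11 / 49" by linarith
    with q show False by (simp add: power2_eq_square)
  qed
qed

lemma nonzero_right_of_0:
  fixes f :: "real \<Rightarrow> real"
  assumes c: "continuous_on UNIV f" "continuous_on UNIV f'"
    and d: "\<And>t. t > 0 \<Longrightarrow> (f has_real_derivative f' t) (at t)"
    and nz: "f 0 \<noteq> 0 \<or> f' 0 \<noteq> 0"
  shows "eventually (\<lambda>t. f t \<noteq> 0) (at_right 0)"
proof (cases "f 0 = 0")
  case False
  have "(f \<longlongrightarrow> f 0) (at_right 0)"
    using c(1) by (auto simp: continuous_on_def intro: tendsto_within_subset)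
  with False show ?thesis by (intro tendsto_imp_eventually_ne)
next
  case True
  with nz have "f' 0 \<noteq> 0" by simp
  moreover have "(f' \<longlongrightarrow> f' 0) (at_right 0)"
    using c(2) by (auto simp: continuous_on_def intro: tendsto_within_subset)
  ultimately have "eventually (\<lambda>t. f' t \<noteq> 0) (at_right 0)" by (intro tendsto_imp_eventually_ne)
  then obtain b where b: "b > 0" "\<And>t. 0 < t \<Longrightarrow> t < b \<Longrightarrow> f' t \<noteq> 0"
    unfolding eventually_at_right_field by auto
  have "f t \<noteq> 0" if t: "0 < t" "t < b" for t
  proof -
    \<comment> \<open>As \<open>f 0 = 0\<close>, the value \<open>f t\<close> is \<open>t\<close> times a derivative at an intermediate point.\<close>
    obtain l z where z: "0 < z" "z < t" "(f has_real_derivative l) (at z)" "f t - f 0 = (t - 0) * l"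
      using MVT[of 0 t f] t(1) c(1) d
      by (meson continuous_on_subset order_less_imp_le real_differentiable_def subset_UNIV)
    then have "l = f' z" using d DERIV_unique by blast
    with z b(2)[of z] t True show ?thesis by simp
  qed
  with b(1) show ?thesis unfolding eventually_at_right_field by blast
qed

text \<open>
  The set of \<open>L\<close> at which the determinant or its \<open>t\<close>-derivative is non-zero is open and dense,
  for each of the two determinants; hence both properties can be had at a common \<open>L\<close>.
\<close>

lemma nondegenerate_near_0:
  assumes "e > 0"
  shows "\<exists>L. \<bar>L - L0\<bar> < e \<and>
    eventually (\<lambda>t. iso_det t L \<noteq> 0 \<and> kol_det t L \<noteq> 0 \<and> act_t 0 t L - act 1 t L > 0) (at_right 0)"
proof -
  have cL: "continuous_on UNIV (\<lambda>L. iso_det 0 L)" "continuous_on UNIV (\<lambda>L. iso_det_t 0 L)"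
    by (rule continuous_on_dets; intro continuous_intros)+
  define S where "S = ball L0 e"
  have S: "open S" "S \<noteq> {}" using assms by (auto simp: S_def)
  define S' where "S' = S \<inter> ({L. iso_det 0 L \<noteq> 0} \<union> {L. iso_det_t 0 L \<noteq> 0})"
  have "open {L. iso_det 0 L \<noteq> 0}" "open {L. iso_det_t 0 L \<noteq> 0}"
    by (rule open_Collect_neq[OF cL(1) continuous_on_const], rule open_Collect_neq[OF cL(2)
        continuous_on_const])
  then have S': "open S'" "S' \<noteq> {}"
    using S iso_det_jet_nonzero[OF S] by (auto simp: S'_def)
  from kol_det_jet_nonzero[OF S'] obtain L where L: "L \<in> S'" "kol_det 0 L \<noteq> 0 \<or> kol_det_t 0 L \<noteq> 0"
      by blast
  have ct: "continuous_on UNIV (\<lambda>t. iso_det t L)" "continuous_on UNIV (\<lambda>t. iso_det_t t L)"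
    "continuous_on UNIV (\<lambda>t. kol_det t L)" "continuous_on UNIV (\<lambda>t. kol_det_t t L)"
    by (rule continuous_on_dets; intro continuous_intros)+
  have "eventually (\<lambda>t. iso_det t L \<noteq> 0) (at_right 0)"
    using L(1) by (intro nonzero_right_of_0[OF ct(1,2) iso_det_deriv]) (auto simp: S'_def)
  moreover have "eventually (\<lambda>t. kol_det t L \<noteq> 0) (at_right 0)"
    using L(2) by (intro nonzero_right_of_0[OF ct(3,4) kol_det_deriv])
  moreover have "eventually (\<lambda>t. act_t 0 t L - act 1 t L > 0) (at_right 0)"
  proof -
    have "continuous_on UNIV (\<lambda>t. act_t 0 t L - act 1 t L)"
      by (intro continuous_intros continuous_on_act; simp)
    then have "((\<lambda>t. act_t 0 t L - act 1 t L) \<longlongrightarrow> act_t 0 0 L - act 1 0 L) (at_right 0)"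
      by (auto simp: continuous_on_def intro: tendsto_within_subset)
    moreover have "act_t 0 0 L - act 1 0 L > 0" using act_t_pos by (simp add: act_at_0(1))
    ultimately show ?thesis by (rule order_tendstoD(1))
  qed
  ultimately have "eventually (\<lambda>t. iso_det t L \<noteq> 0 \<and> kol_det t L \<noteq> 0 \<and> act_t 0 t L - act 1 t L >
      0) (at_right 0)"
    by eventually_elim blast
  moreover have "\<bar>L - L0\<bar> < e" using L(1) by (auto simp: S'_def S_def dist_real_def)
  ultimately show ?thesis by blast
qed

end

section \<open>The energy as a function of the actions\<close>

lemma has_derivative_of_continuous_partials:
  fixes f :: "real \<Rightarrow> real \<Rightarrow> real"
  assumes x: "x \<in> X" "open X"
    and fx: "((\<lambda>x. f x y) has_real_derivative fx) (at x)"
    and fy: "\<And>x y. x \<in> X \<Longrightarrow> ((\<lambda>y. f x y) has_real_derivative fy x y) (at y)"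
    and c: "continuous_on (X \<times> UNIV) (\<lambda>(x, y). fy x y)"
  shows "((\<lambda>(x, y). f x y) has_derivative (\<lambda>(u, v). fx * u + fy x y * v)) (at (x, y))"
proof -
  have "((\<lambda>(x, y). f x y) has_derivative (\<lambda>(tx, ty). fx * tx + blinfun_apply (blinfun_mult_right
      (fy x y)) ty))
     (at (x, y) within X \<times> UNIV)"
  proof (rule has_derivative_partialsI)
    show "((\<lambda>x. f x y) has_derivative (*) fx) (at x within X)"
      using fx by (auto simp: has_field_derivative_def intro: has_derivative_at_withinI)
    show "(f x has_derivative blinfun_apply (blinfun_mult_right (fy x y))) (at y within UNIV)"
      if "x \<in> X" for x y
      using fy[OF that] by (simp add: has_field_derivative_def)
    have "continuous_on (X \<times> UNIV) (\<lambda>z. blinfun_mult_right ((\<lambda>(x, y). fy x y) z))"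
      by (rule bounded_linear.continuous_on[OF bounded_linear_blinfun_mult_right c])
    then have "continuous_on (X \<times> UNIV) (\<lambda>(x, y). blinfun_mult_right (fy x y))"
      by (simp add: case_prod_unfold)
    then show "continuous (at (x, y) within X \<times> UNIV) (\<lambda>(x, y). blinfun_mult_right (fy x y))"
      unfolding continuous_on_eq_continuous_within using x by blast
  qed (use x in auto)
  moreover have "at (x, y) within X \<times> UNIV = at (x, y)"
    using x by (intro at_within_open) (auto intro: open_Times)
  ultimately show ?thesis by simp
qed

context oscillator
begin

lemma act_has_derivative:
  assumes "t > 0"
  shows "j < 4 \<Longrightarrow> ((\<lambda>(t, L). act j t L) has_derivative (\<lambda>(u, v). act_t j t L * u + act (Suc j) t L
      * v)) (at (t, L))"
    and "((\<lambda>(t, L). act_t 0 t L) has_derivative (\<lambda>(u, v). act_tt 0 t L * u + act_t 1 t L * v)) (at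
    (t, L))"
proof -
  assume j: "j < 4"
  show "((\<lambda>(t, L). act j t L) has_derivative (\<lambda>(u, v). act_t j t L * u + act (Suc j) t L * v)) (at
      (t, L))"
    using assms j
    by (intro has_derivative_of_continuous_partials[where X = "{0<..}"] act_deriv_t act_deriv_L)
       (auto simp: case_prod_beta intro!: continuous_on_act continuous_intros)
next
  show "((\<lambda>(t, L). act_t 0 t L) has_derivative (\<lambda>(u, v). act_tt 0 t L * u + act_t 1 t L * v)) (at
      (t, L))"
    using assms
    by (intro has_derivative_of_continuous_partials[where X = "{0<..}"] act_t_deriv_t)
       (use act_deriv_L(2)[of 0] in \<open>auto simp: case_prod_beta intro!: continuous_on_act
           continuous_intros\<close>)
qed

lemma act_strict_mono:
  assumes "0 \<le> s" "s < t"
  shows "act 0 s L < act 0 t L"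
  using assms(2)
proof (rule DERIV_pos_imp_increasing_open)
  show "\<exists>y. ((\<lambda>t. act 0 t L) has_real_derivative y) (at x) \<and> 0 < y" if "s < x" "x < t" for x
    using act_deriv_t[of 0 x L] act_t_pos that assms(1) by auto
  show "continuous_on {s..t} (\<lambda>t. act 0 t L)"
    by (intro continuous_on_act continuous_intros) simp
qed

text \<open>
  The energy in terms of the action. The boundary value \<open>t = 0\<close> is included because the energy
  has to be given at the equilibria, too.
\<close>

definition excess :: "real \<Rightarrow> real \<Rightarrow> real" where
  "excess A L = (THE t. t \<ge> 0 \<and> act 0 t L = A)"

lemma excess_act: "t \<ge> 0 \<Longrightarrow> excess (act 0 t L) L = t"
  unfolding excess_def by (rule the_equality) (auto, metis act_strict_mono less_irrefl linorder_neqE)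

text \<open>
  Keeping \<open>L\<close> as a second coordinate makes the inversion of \<open>a\<close> an instance of the inverse
  function theorem in the plane, which yields joint differentiability.
\<close>

definition act_map :: "real \<times> real \<Rightarrow> real \<times> real" where
  "act_map = (\<lambda>(t, L). (act 0 t L, L))"

definition act_range :: "(real \<times> real) set" where
  "act_range = act_map ` ({0<..} \<times> UNIV)"

lemma continuous_on_act_map: "continuous_on S act_map"
  unfolding act_map_def case_prod_beta by (intro continuous_intros continuous_on_act) simp

lemma open_act_range: "open act_range"
  unfolding act_range_def
proof (rule invariance_of_domain)
  show "inj_on act_map ({0<..} \<times> UNIV)"
    by (rule inj_on_inverseI[where g = "\<lambda>(A, L). (excess A L, L)"]) (auto simp: act_map_def excess_act)
qed (auto intro: continuous_on_act_map open_Times)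

lemma excess_has_derivative:
  assumes "t > 0"
  shows "((\<lambda>(A, L). excess A L) has_derivative (\<lambda>(u, v). (u - act 1 t L * v) / act_t 0 t L)) (at
      (act 0 t L, L))"
proof -
  have "((\<lambda>(A, L). (excess A L, L)) has_derivative (\<lambda>(u, v). ((u - act 1 t L * v) / act_t 0 t L,
      v))) (at (act_map (t, L)))"
  proof (rule has_derivative_inverse_strong[where S = "{0::real<..} \<times> (UNIV :: real set)" and f =
      act_map and x = "(t, L)"])
    show "open ({0::real<..} \<times> (UNIV :: real set))" by (auto intro: open_Times)
    show "continuous_on ({0::real<..} \<times> (UNIV :: real set)) act_map" by (rule continuous_on_act_map)
    have "act_map = (\<lambda>z. ((\<lambda>(t, L). act 0 t L) z, snd z))" by (auto simp: act_map_def)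
    moreover have "((\<lambda>z. ((\<lambda>(t, L). act 0 t L) z, snd z)) has_derivative
        (\<lambda>z. ((\<lambda>(u, v). act_t 0 t L * u + act 1 t L * v) z, snd z))) (at (t, L))"
      using act_has_derivative(1)[of t 0 L] assms by (intro has_derivative_Pair) (auto intro!:
          derivative_eq_intros)
    ultimately show "(act_map has_derivative (\<lambda>z. ((\<lambda>(u, v). act_t 0 t L * u + act 1 t L * v) z,
        snd z))) (at (t, L))"
      by simp
    show "(\<lambda>z. ((\<lambda>(u, v). act_t 0 t L * u + act 1 t L * v) z, snd z)) \<circ>
      (\<lambda>(u, v). ((u - act 1 t L * v) / act_t 0 t L, v)) = id"
      using act_t_pos[of t L] by (auto simp: fun_eq_iff)
  qed (use assms in \<open>auto simp: act_map_def excess_act\<close>)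
  from has_derivative_fst[OF this] show ?thesis
    by (simp add: case_prod_unfold act_map_def)
qed

end

lemma sum_UNIV_option: "(\<Sum>i\<in>UNIV. f i) = f None + (\<Sum>i\<in>UNIV. f (Some (i :: 'a :: finite)))"
  by (simp add: UNIV_option_conv sum.reindex)

lemma has_derivative_vec_lambda:
  fixes f :: "'i::finite \<Rightarrow> 'a::real_normed_vector \<Rightarrow> real"
  assumes "\<And>i. (f i has_derivative f' i) (at x)"
  shows "((\<lambda>x. \<chi> i. f i x) has_derivative (\<lambda>v. \<chi> i. f' i v)) (at x)"
  unfolding has_derivative_componentwise_within[of "\<lambda>x. \<chi> i. f i x"]
  using assms by (auto simp: Basis_vec_def inner_axis)

text \<open>
  The coordinate \<open>L\<close> in terms of the momenta, \<open>B\<close> being the matrix of the dual metric.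
\<close>

definition log_size :: "real \<Rightarrow> real^'n^'n \<Rightarrow> real^'n \<Rightarrow> real" where
  "log_size c B P = ln (P \<bullet> (B *v P) / c) / 2"

locale inverse_metric =
  fixes B :: "real^'n^'n"
  assumes sym: "transpose B = B" and pos: "v \<noteq> 0 \<Longrightarrow> v \<bullet> (B *v v) > 0"
begin

lemma inner_swap: "u \<bullet> (B *v v) = v \<bullet> (B *v u)"
  by (metis dot_lmul_matrix inner_commute sym vector_transpose_matrix)

lemma log_size_has_derivative:
  assumes "P \<noteq> 0" "c > 0"
  shows "(log_size c B has_derivative (\<lambda>v. ((B *v P) \<bullet> v) / (P \<bullet> (B *v P)))) (at P)"
proof -
  have q: "P \<bullet> (B *v P) > 0" by (rule pos[OF assms(1)])
  have *: "P \<bullet> (B *v v) + v \<bullet> (B *v P) = 2 * ((B *v P) \<bullet> v)" for v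
    using inner_swap[of P v] by (simp add: inner_commute)
  have dB: "((\<lambda>P. B *v P) has_derivative (\<lambda>v. B *v v)) (at P)"
    by (rule bounded_linear_imp_has_derivative) simp
  have dq: "((\<lambda>P. P \<bullet> (B *v P)) has_derivative (\<lambda>v. 2 * ((B *v P) \<bullet> v))) (at P)"
    unfolding *[symmetric] by (rule has_derivative_inner[OF has_derivative_ident dB])
  have "((\<lambda>x. ln (x / c) / 2) has_real_derivative 1 / (2 * (P \<bullet> (B *v P)))) (at (P \<bullet> (B *v P)))"
    using q assms(2) by (auto intro!: derivative_eq_intros simp: field_simps)
  from DERIV_compose_FDERIV[OF this dq] show ?thesis
    unfolding log_size_def[abs_def] by (simp add: field_simps)
qed

end
text \<open>
  Action vectors are indexed by \<open>'n option\<close>: the index \<open>None\<close> belongs to the action \<open>A\<close>, the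
  other ones to the momenta.
\<close>

definition momenta :: "real^('n option) \<Rightarrow> real^'n" where
  "momenta J = (\<chi> i. J $ Some i)"

lemma momenta_add: "momenta (u + v) = momenta u + momenta v"
  and momenta_scale: "momenta (r *\<^sub>R v) = r *\<^sub>R momenta v"
  and momenta_nth [simp]: "momenta v $ i = v $ Some i"
  by (simp_all add: momenta_def vec_eq_iff)

lemma bounded_linear_momenta: "bounded_linear (momenta :: real^('n::finite option) \<Rightarrow> real^'n)"
  by (rule linear_conv_bounded_linear[THEN iffD1]) (simp add: linear_iff momenta_add momenta_scale)

lemma eq_0_option_vec: "v = 0 \<longleftrightarrow> v $ None = 0 \<and> momenta v = 0"
  by (auto simp: vec_eq_iff momenta_def) (metis option.exhaust)

lemma inner_option_vec: "u \<bullet> v = u $ None * v $ None + momenta u \<bullet> momenta v"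
  for u v :: "real^('n::finite option)"
  by (simp add: inner_vec_def sum_UNIV_option)

lemma det_nonzero_if_injective:
  fixes M :: "real^'m^'m"
  assumes "\<And>v. M *v v = 0 \<Longrightarrow> v = 0" shows "det M \<noteq> 0"
proof -
  have "inj ((*v) M)" using assms by (simp add: linear_injective_0)
  then show ?thesis using det_nz_iff_inj[of "(*v) M"] by simp
qed

text \<open>
  The border of a vector indexed by \<open>'n option option\<close> is its component at the outer \<open>None\<close>, and
  \<open>momenta\<close> strips that border off.
\<close>

lemma bordered_matrix_mult:
  "(bordered_matrix M w *v x) $ Some i = (M *v momenta x) $ i + x $ None * w $ i"
  "(bordered_matrix M w *v x) $ None = w \<bullet> momenta x"
  by (simp_all add: matrix_vector_mult_def bordered_matrix_def sum_UNIV_option inner_vec_def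
      mult.commute)

text \<open>
  Here \<open>action_energy\<close> is the function \<open>h\<close>, \<open>frequency\<close> its gradient, and \<open>regular_actions\<close> the
  open set of actions with \<open>A > 0\<close> that are attained.
\<close>

locale action_hamiltonian = oscillator G + inverse_metric B
  for G :: "nat \<Rightarrow> real \<Rightarrow> real" and B :: "real^'n::finite^'n" +
  fixes c :: real
  assumes c_pos: "c > 0"
begin

definition action_log_size :: "real^('n option) \<Rightarrow> real" where
  "action_log_size J = log_size c B (momenta J)"

definition action_excess :: "real^('n option) \<Rightarrow> real" where
  "action_excess J = excess (J $ None) (action_log_size J)"

definition action_energy :: "real^('n option) \<Rightarrow> real" where
  "action_energy J = c * (action_log_size J + action_excess J + 1 / 2)"

definition regular_actions :: "(real^('n option)) set" where
  "regular_actions = {J. momenta J \<noteq> 0 \<and> (J $ None, action_log_size J) \<in> act_range}"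

text \<open>
  In the notation \<open>a(t, L)\<close>, these are \<open>a\<^sub>t\<close> and \<open>a\<^sub>t - a\<^sub>L\<close>. The gradient of \<open>h\<close> is \<open>c / a\<^sub>t\<close>
  in the direction of \<open>A\<close> and \<open>c (a\<^sub>t - a\<^sub>L) / a\<^sub>t\<close> times the gradient of \<open>L\<close> in the directions
  of the momenta.
\<close>

definition period_factor :: "real^('n option) \<Rightarrow> real" where
  "period_factor J = act_t 0 (action_excess J) (action_log_size J)"

definition drift_factor :: "real^('n option) \<Rightarrow> real" where
  "drift_factor J = act_t 0 (action_excess J) (action_log_size J) - act 1 (action_excess J)
      (action_log_size J)"

definition size_sq :: "real^('n option) \<Rightarrow> real" where
  "size_sq J = momenta J \<bullet> (B *v momenta J)"

definition frequency :: "real^('n option) \<Rightarrow> real^('n option)" where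
  "frequency J = (\<chi> i. case i of None \<Rightarrow> c / period_factor J
     | Some i \<Rightarrow> c * (drift_factor J / period_factor J * ((B *v momenta J) $ i / size_sq J)))"

lemma regular_actionsD:
  assumes "J \<in> regular_actions"
  shows "momenta J \<noteq> 0" "action_excess J > 0" "J $ None = act 0 (action_excess J) (action_log_size J)"
  using assms by (auto simp: regular_actions_def act_range_def act_map_def action_excess_def excess_act)

lemma size_sq_pos: "J \<in> regular_actions \<Longrightarrow> size_sq J > 0"
  unfolding size_sq_def by (rule pos[OF regular_actionsD(1)])

lemma period_factor_pos: "period_factor J > 0"
  unfolding period_factor_def by (rule act_t_pos)

definition dlog_size :: "real^('n option) \<Rightarrow> real^('n option) \<Rightarrow> real" where
  "dlog_size J v = ((B *v momenta J) \<bullet> momenta v) / size_sq J"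

lemma action_log_size_has_derivative:
  assumes "momenta J \<noteq> 0"
  shows "(action_log_size has_derivative dlog_size J) (at J)"
  unfolding action_log_size_def[abs_def] dlog_size_def[abs_def] size_sq_def
  by (rule has_derivative_compose[OF bounded_linear_imp_has_derivative[OF bounded_linear_momenta]
        log_size_has_derivative[OF assms c_pos]])

lemma open_regular_actions: "open regular_actions"
proof -
  have "open {J :: real^('n option). momenta J \<noteq> 0}"
    by (intro open_Collect_neq bounded_linear.continuous_on[OF bounded_linear_momenta]
        continuous_intros)
  moreover have "continuous_on {J. momenta J \<noteq> 0} (\<lambda>J. (J $ None, action_log_size J))"
    by (intro continuous_intros continuous_at_imp_continuous_on ballI
        has_derivative_continuous[OF action_log_size_has_derivative]) auto
  ultimately have "open ({J. momenta J \<noteq> 0} \<inter> (\<lambda>J. (J $ None, action_log_size J)) -` act_range)"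
    by (intro continuous_open_preimage open_act_range)
  then show ?thesis by (simp add: regular_actions_def vimage_def Int_def)
qed

context
  fixes J :: "real^('n option)"
  assumes J: "J \<in> regular_actions"
begin

text \<open>
  The rate of change of \<open>t\<close> when the actions move with velocity \<open>v\<close>.
\<close>

definition dexcess :: "real^('n option) \<Rightarrow> real" where
  "dexcess v = (v $ None - act 1 (action_excess J) (action_log_size J) * dlog_size J v) /
      period_factor J"

lemma action_excess_has_derivative: "(action_excess has_derivative dexcess) (at J)"
proof -
  have "((\<lambda>J. (J $ None, action_log_size J)) has_derivative (\<lambda>v. (v $ None, dlog_size J v))) (at J)"
    by (intro has_derivative_Pair action_log_size_has_derivative regular_actionsD[OF J]
        bounded_linear_imp_has_derivative bounded_linear_vec_nth)
  moreover have "((\<lambda>(A, L). excess A L) has_derivative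
      (\<lambda>(u, v). (u - act 1 (action_excess J) (action_log_size J) * v) / act_t 0 (action_excess J)
          (action_log_size J)))
      (at (J $ None, action_log_size J))"
    using excess_has_derivative[OF regular_actionsD(2)[OF J], of "action_log_size J"]
    unfolding regular_actionsD(3)[OF J, symmetric] .
  ultimately show ?thesis
    unfolding action_excess_def[abs_def] dexcess_def[abs_def] period_factor_def
    using has_derivative_compose by (fastforce simp: action_excess_def)
qed

lemma act_along_actions:
  assumes "((\<lambda>(t, L). f t L) has_derivative (\<lambda>(u, v). a * u + b * v)) (at (action_excess J,
      action_log_size J))"
  shows "((\<lambda>J. f (action_excess J) (action_log_size J)) has_derivative
    (\<lambda>v. a * dexcess v + b * dlog_size J v)) (at J)"
  using has_derivative_compose[OF has_derivative_Pair[OF action_excess_has_derivative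
        action_log_size_has_derivative[OF regular_actionsD(1)[OF J]]] assms]
  by simp

abbreviation "at_J f \<equiv> f (action_excess J) (action_log_size J)"

definition dperiod :: "real^('n option) \<Rightarrow> real" where
  "dperiod v = at_J (act_tt 0) * dexcess v + at_J (act_t 1) * dlog_size J v"

definition ddrift :: "real^('n option) \<Rightarrow> real" where
  "ddrift v = dperiod v - (at_J (act_t 1) * dexcess v + at_J (act 2) * dlog_size J v)"

lemma period_factor_has_derivative: "(period_factor has_derivative dperiod) (at J)"
  unfolding period_factor_def[abs_def] dperiod_def[abs_def]
  by (rule act_along_actions[OF act_has_derivative(2)[OF regular_actionsD(2)[OF J]]])

lemma drift_factor_has_derivative: "(drift_factor has_derivative ddrift) (at J)"
  unfolding drift_factor_def[abs_def] ddrift_def[abs_def]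
  using act_along_actions[OF act_has_derivative(1)[OF regular_actionsD(2)[OF J], of 1]]
    period_factor_has_derivative
  by (intro has_derivative_diff) (simp_all add: period_factor_def[abs_def] numeral_2_eq_2)

lemma frequency_inner: "frequency J \<bullet> v = c * (dlog_size J v + dexcess v)"
proof -
  have "momenta (frequency J) = (c * (drift_factor J / period_factor J) / size_sq J) *\<^sub>R (B *v
      momenta J)"
    by (simp add: vec_eq_iff frequency_def)
  then have "frequency J \<bullet> v = c / period_factor J * v $ None + c * (drift_factor J /
      period_factor J) * dlog_size J v"
    by (simp add: inner_option_vec frequency_def dlog_size_def)
  also have "\<dots> = c * (dlog_size J v + dexcess v)"
    using period_factor_pos[of J] unfolding dexcess_def drift_factor_def
    by (simp add: period_factor_def[symmetric] field_simps)
  finally show ?thesis .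
qed

lemma action_energy_has_derivative: "(action_energy has_derivative (\<lambda>v. frequency J \<bullet> v)) (at J)"
  unfolding frequency_inner action_energy_def[abs_def]
  by (auto intro!: derivative_eq_intros action_excess_has_derivative
      action_log_size_has_derivative regular_actionsD[OF J])

definition dfrequency :: "real^('n option) \<Rightarrow> real^('n option)" where
  "dfrequency v = (\<chi> i. case i of None \<Rightarrow> - (c * dperiod v) / (period_factor J * period_factor J)
     | Some i \<Rightarrow> c * (drift_factor J / period_factor J *
          (((B *v momenta v) $ i * size_sq J - (B *v momenta J) $ i * (2 * ((B *v momenta J) \<bullet>
              momenta v))) / (size_sq J * size_sq J))
        + (ddrift v * period_factor J - drift_factor J * dperiod v) / (period_factor J *
        period_factor J)
          * ((B *v momenta J) $ i / size_sq J)))"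

lemma size_sq_has_derivative: "(size_sq has_derivative (\<lambda>v. 2 * ((B *v momenta J) \<bullet> momenta v))) (at J)"
proof -
  have m: "(momenta has_derivative momenta) (at J)"
    by (rule bounded_linear_imp_has_derivative[OF bounded_linear_momenta])
  have "(size_sq has_derivative (\<lambda>v. momenta J \<bullet> (B *v momenta v) + momenta v \<bullet> (B *v momenta J)))
      (at J)"
    unfolding size_sq_def[abs_def]
    by (intro has_derivative_inner m has_derivative_compose[OF m
        bounded_linear_imp_has_derivative[OF matrix_vector_mul_bounded_linear]])
  moreover have "momenta J \<bullet> (B *v momenta v) + momenta v \<bullet> (B *v momenta J) = 2 * ((B *v momenta
      J) \<bullet> momenta v)" for v
    using inner_swap[of "momenta J" "momenta v"] by (simp add: inner_commute)
  ultimately show ?thesis by simp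
qed

lemma frequency_has_derivative: "(frequency has_derivative dfrequency) (at J)"
  unfolding frequency_def[abs_def] dfrequency_def[abs_def]
proof (rule has_derivative_vec_lambda)
  fix i :: "'n option"
  have p: "period_factor J \<noteq> 0" using period_factor_pos[of J] by simp
  have q: "size_sq J \<noteq> 0" using size_sq_pos[OF J] by simp
  show "((\<lambda>J. case i of None \<Rightarrow> c / period_factor J
     | Some i \<Rightarrow> c * (drift_factor J / period_factor J * ((B *v momenta J) $ i / size_sq J)))
     has_derivative
   (\<lambda>v. case i of None \<Rightarrow> - (c * dperiod v) / (period_factor J * period_factor J)
     | Some i \<Rightarrow> c * (drift_factor J / period_factor J *
          (((B *v momenta v) $ i * size_sq J - (B *v momenta J) $ i * (2 * ((B *v momenta J) \<bullet>
              momenta v))) / (size_sq J * size_sq J))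
        + (ddrift v * period_factor J - drift_factor J * dperiod v) / (period_factor J *
        period_factor J)
          * ((B *v momenta J) $ i / size_sq J)))) (at J)"
  proof (cases i)
    case None
    have "((\<lambda>J. c / period_factor J) has_derivative
       (\<lambda>v. (0 * period_factor J - c * dperiod v) / (period_factor J * period_factor J))) (at J)"
      by (rule has_derivative_divide'[OF has_derivative_const period_factor_has_derivative p])
    with None show ?thesis by simp
  next
    case (Some i)
    have "((\<lambda>J. (B *v momenta J) $ i) has_derivative (\<lambda>v. (B *v momenta v) $ i)) (at J)"
      by (intro bounded_linear_imp_has_derivative bounded_linear_compose[OF bounded_linear_vec_nth]
          bounded_linear_compose[OF matrix_vector_mul_bounded_linear] bounded_linear_momenta)
    then have "((\<lambda>J. c * (drift_factor J / period_factor J * ((B *v momenta J) $ i / size_sq J)))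
        has_derivative
      (\<lambda>v. c * (drift_factor J / period_factor J *
          (((B *v momenta v) $ i * size_sq J - (B *v momenta J) $ i * (2 * ((B *v momenta J) \<bullet>
              momenta v))) / (size_sq J * size_sq J))
        + (ddrift v * period_factor J - drift_factor J * dperiod v) / (period_factor J *
        period_factor J)
          * ((B *v momenta J) $ i / size_sq J)))) (at J)"
      by (intro has_derivative_mult_right has_derivative_mult has_derivative_divide' p q
          drift_factor_has_derivative period_factor_has_derivative size_sq_has_derivative)
    with Some show ?thesis by simp
  qed
qed

text \<open>
  The eigenvalue-like parameter \<open>l\<close> serves both conditions: \<open>l = 0\<close> describes the kernel of the
  Hessian, and for the bordered matrix \<open>l\<close> is the extra component. The momentum part of the
  equation is a vanishing linear combination of \<open>p\<close> and its variation, which is therefore a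
  multiple of \<open>p\<close>; the scalar product with \<open>p\<close> then gives the remaining equation.
\<close>

lemma frequency_kernel:
  assumes v: "dfrequency v = - l *\<^sub>R frequency J" and drift: "drift_factor J > 0"
  shows "momenta v = dlog_size J v *\<^sub>R momenta J"
    "ddrift v = drift_factor J * dlog_size J v" "dperiod v = l * period_factor J"
proof -
  define a d q b where abdq: "a = period_factor J" "d = drift_factor J" "q = size_sq J" "b = d / a"
  \<comment> \<open>\<open>b\<close> is the factor of the gradient of \<open>L\<close> in the frequency and \<open>b'\<close> its rate of change.\<close>
  define b' L' where bL: "b' = (ddrift v * a - d * dperiod v) / (a * a)" "L' = dlog_size J v"
  have a: "a > 0" and d: "d > 0" and q: "q > 0" and b: "b > 0"
    using period_factor_pos[of J] drift size_sq_pos[OF J] by (simp_all add: abdq)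
  have L': "(B *v momenta J) \<bullet> momenta v = L' * q" using q by (simp add: bL dlog_size_def abdq)
  have P: "(B *v momenta J) \<bullet> momenta J = q" by (simp add: abdq size_sq_def inner_commute)
  have "dfrequency v $ None = - l * frequency J $ None" using v by simp
  then have "c * dperiod v = c * (l * a)"
    using a c_pos by (simp add: dfrequency_def frequency_def abdq[symmetric] field_simps)
  then show per: "dperiod v = l * period_factor J" using c_pos by (simp add: abdq)
  have "B *v (b *\<^sub>R momenta v + (b' - 2 * b * L' + l * b) *\<^sub>R momenta J) = 0"
  proof (simp only: vec_eq_iff, intro allI)
    fix i
    define x y where xy: "x = (B *v momenta v) $ i" "y = (B *v momenta J) $ i"
    have "dfrequency v $ Some i = - l * frequency J $ Some i" using v by simp
    then have "c * (b * ((x * q - y * (2 * (L' * q))) / (q * q)) + b' * (y / q)) = - l * (c * (b *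
        (y / q)))"
      by (simp add: dfrequency_def frequency_def abdq[symmetric] bL[symmetric] xy[symmetric] L')
    then have "q * (q * (c * (b * x + (b' - 2 * b * L' + l * b) * y))) = 0"
      using q by (simp add: field_simps)
    then have "c * (b * x + (b' - 2 * b * L' + l * b) * y) = 0" using q by simp
    then show "(B *v (b *\<^sub>R momenta v + (b' - 2 * b * L' + l * b) *\<^sub>R momenta J)) $ i = 0 $ i"
      using c_pos by (simp add: xy matrix_vector_right_distrib
          scaleR_matrix_vector_assoc[symmetric] matrix_vector_mult_scaleR)
  qed
  then have vec: "b *\<^sub>R momenta v + (b' - 2 * b * L' + l * b) *\<^sub>R momenta J = 0"
    using pos inner_zero_right by (metis less_irrefl)
  then have "(B *v momenta J) \<bullet> (b *\<^sub>R momenta v + (b' - 2 * b * L' + l * b) *\<^sub>R momenta J) = 0" by simp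
  then have "b * (L' * q) + (b' - 2 * b * L' + l * b) * q = 0"
    by (simp only: inner_add_right inner_scaleR_right L' P)
  then have "(b' - b * L' + l * b) * q = 0" by (simp add: algebra_simps)
  with q have b': "b' = b * L' - l * b" by simp
  from vec have "b *\<^sub>R (momenta v - L' *\<^sub>R momenta J) = 0" by (simp add: b' algebra_simps)
  with b show "momenta v = dlog_size J v *\<^sub>R momenta J" by (simp add: bL)
  have "ddrift v * a - d * (l * a) = (b * L' - l * b) * (a * a)"
    using b' a per by (simp add: bL abdq field_simps)
  also have "\<dots> = (d * L' - l * d) * a" using a by (simp add: abdq(4) field_simps)
  finally have "(ddrift v - d * L') * a = 0" by (simp add: algebra_simps)
  with a show "ddrift v = drift_factor J * dlog_size J v" by (simp add: abdq bL)
qed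

lemma eq_0_from_rates:
  assumes "dlog_size J v = 0" "dexcess v = 0" "momenta v = dlog_size J v *\<^sub>R momenta J"
  shows "v = 0"
  using assms period_factor_pos[of J] by (simp add: eq_0_option_vec dexcess_def)

text \<open>
  By \<open>frequency_kernel\<close> the rates of \<open>t\<close> and \<open>L\<close> solve a homogeneous linear system of two
  equations with determinant \<open>kol_det\<close>.
\<close>

lemma dfrequency_injective:
  assumes v: "dfrequency v = 0" and drift: "drift_factor J > 0" and K: "at_J kol_det \<noteq> 0"
  shows "v = 0"
proof -
  define t' L' where tL: "t' = dexcess v" "L' = dlog_size J v"
  have k: "momenta v = L' *\<^sub>R momenta J" "ddrift v = drift_factor J * L'" "dperiod v = 0"
    using frequency_kernel[of v 0] v drift by (simp_all add: tL)
  have e1: "at_J (act_tt 0) * t' + at_J (act_t 1) * L' = 0" using k(3) by (simp add: dperiod_def tL)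
  have e2: "at_J (act_t 1) * t' + (at_J (act 2) + at_J (act_t 0) - at_J (act 1)) * L' = 0"
    using k(2,3) by (simp add: ddrift_def drift_factor_def tL algebra_simps)
  have "at_J kol_det * L' = at_J (act_tt 0) * (at_J (act_t 1) * t' + (at_J (act 2) + at_J (act_t
      0) - at_J (act 1)) * L')
     - at_J (act_t 1) * (at_J (act_tt 0) * t' + at_J (act_t 1) * L')"
    by (simp add: kol_det_def algebra_simps power2_eq_square)
  then have L0: "L' = 0" using e1 e2 K by simp
  have "at_J kol_det * t' = (at_J (act 2) + at_J (act_t 0) - at_J (act 1)) * (at_J (act_tt 0) * t'
      + at_J (act_t 1) * L')
     - at_J (act_t 1) * (at_J (act_t 1) * t' + (at_J (act 2) + at_J (act_t 0) - at_J (act 1)) * L')"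
    by (simp add: kol_det_def algebra_simps power2_eq_square)
  then have "t' = 0" using e1 e2 K by simp
  with L0 k(1) show ?thesis by (intro eq_0_from_rates) (simp_all add: tL)
qed

text \<open>
  Orthogonality to the frequency means that the energy \<open>c (L + t + 1/2)\<close> is stationary, so that
  the rates of \<open>t\<close> and \<open>L\<close> are opposite; the remaining scalar equation has the coefficient
  \<open>iso_det\<close>.
\<close>

lemma bordered_injective:
  assumes v: "dfrequency v + l *\<^sub>R frequency J = 0" "frequency J \<bullet> v = 0"
    and drift: "drift_factor J > 0" and K: "at_J iso_det \<noteq> 0"
  shows "v = 0" "l = 0"
proof -
  define t' L' where tL: "t' = dexcess v" "L' = dlog_size J v"
  have "dfrequency v = - l *\<^sub>R frequency J" using v(1) by (simp add: eq_neg_iff_add_eq_0)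
  from frequency_kernel[OF this drift]
  have k: "momenta v = L' *\<^sub>R momenta J" "ddrift v = drift_factor J * L'" "dperiod v = l *
      period_factor J"
    by (simp_all add: tL)
  have "c * (L' + t') = 0"
    using v(2) by (simp add: frequency_inner tL)
  then have t': "t' = - L'" using c_pos by simp
  have "at_J iso_det * L' = 0"
    using k(2) by (simp add: ddrift_def dperiod_def drift_factor_def iso_det_def tL(1)[symmetric]
        tL(2)[symmetric] t' algebra_simps)
  with K have L0: "L' = 0" by simp
  then show "v = 0" using t' k(1) by (intro eq_0_from_rates) (simp_all add: tL)
  have "dperiod v = 0" using L0 t' by (simp add: dperiod_def tL)
  then show "l = 0" using k(3) period_factor_pos[of J] by simp
qed

lemma linear_dfrequency: "linear dfrequency"
  by (rule has_derivative_linear[OF frequency_has_derivative])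

end

lemma frequency_data_action_energy:
  assumes "J \<in> regular_actions"
  shows "frequency_data S action_energy J frequency (matrix (dfrequency J))"
  unfolding frequency_data_def
proof (intro conjI exI ballI)
  show "open regular_actions" "J \<in> regular_actions" by (fact open_regular_actions assms)+
  show "(action_energy has_derivative (\<lambda>v. frequency I \<bullet> v)) (at I within S)" if "I \<in>
      regular_actions \<inter> S" for I
    using that by (intro has_derivative_at_withinI[OF action_energy_has_derivative]) simp
  have "(*v) (matrix (dfrequency J)) = dfrequency J"
    using linear_dfrequency[OF assms] by (simp add: fun_eq_iff)
  then show "(frequency has_derivative (*v) (matrix (dfrequency J))) (at J within S)"
    using frequency_has_derivative[OF assms] by (simp add: has_derivative_at_withinI)
qed

lemma kolmogorov_nondegenerate_action_energy:
  assumes J: "J \<in> regular_actions" and "drift_factor J > 0" "kol_det (action_excess J)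
      (action_log_size J) \<noteq> 0"
  shows "kolmogorov_nondegenerate_at S action_energy J"
  unfolding kolmogorov_nondegenerate_at_def
proof (intro exI conjI)
  show "frequency_data S action_energy J frequency (matrix (dfrequency J))"
    by (rule frequency_data_action_energy[OF J])
  show "det (matrix (dfrequency J)) \<noteq> 0"
    using dfrequency_injective[OF J] linear_dfrequency[OF J] assms
    by (intro det_nonzero_if_injective) simp
qed

lemma isoenergetically_nondegenerate_action_energy:
  assumes J: "J \<in> regular_actions" and "drift_factor J > 0" "iso_det (action_excess J)
      (action_log_size J) \<noteq> 0"
  shows "isoenergetically_nondegenerate_at S action_energy J"
  unfolding isoenergetically_nondegenerate_at_def
proof (intro exI conjI)
  show "frequency_data S action_energy J frequency (matrix (dfrequency J))"
    by (rule frequency_data_action_energy[OF J])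
  show "det (bordered_matrix (matrix (dfrequency J)) (frequency J)) \<noteq> 0"
  proof (rule det_nonzero_if_injective)
    fix x :: "real^('n option option)"
    assume "bordered_matrix (matrix (dfrequency J)) (frequency J) *v x = 0"
    then have x: "(bordered_matrix (matrix (dfrequency J)) (frequency J) *v x) $ i = 0" for i by simp
    have "dfrequency J (momenta x) + (x $ None) *\<^sub>R frequency J = 0"
      using x[of "Some _"] linear_dfrequency[OF J] by (simp add: vec_eq_iff bordered_matrix_mult)
    moreover have "frequency J \<bullet> momenta x = 0" using x[of None] by (simp add: bordered_matrix_mult)
    ultimately have "momenta x = 0" "x $ None = 0"
      using bordered_injective[OF J _ _ assms(2,3)] by blast+
    then show "x = 0" by (simp add: eq_0_option_vec)
  qed
qed

end

section \<open>The level curves\<close>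

context oscillator
begin

definition loop_log :: "real \<Rightarrow> real \<Rightarrow> real \<Rightarrow> real" where
  "loop_log L R u = L + displacement (R * cos (2 * pi * u))"

text \<open>
  The level curve, parametrised by the angle \<open>2 \<pi> u\<close>. Here \<open>G 0 l * exp (- l)\<close> is the square
  root of \<open>2 c\<close> over the inverse mass. The sign of the second component is chosen so that \<open>p\<^sub>s
  ds\<close> integrates to a non-negative number.
\<close>

definition level_loop :: "real \<Rightarrow> real \<Rightarrow> real \<Rightarrow> real \<times> real" where
  "level_loop L R u = (exp (loop_log L R u), - R * sin (2 * pi * u) * (G 0 (loop_log L R u) * exp
      (- loop_log L R u)))"

lemma loop_log_deriv:
  "(loop_log L R has_real_derivative - (2 * pi * R * sin (2 * pi * u) * disp_deriv 1 (R * cos (2 *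
      pi * u)))) (at u)"
proof -
  have "((\<lambda>u. displacement (R * cos (2 * pi * u))) has_real_derivative
      disp_deriv 1 (R * cos (2 * pi * u)) * (R * - (2 * pi * sin (2 * pi * u)))) (at u)"
    using disp_deriv_DERIV[of 0] unfolding disp_deriv_0
    by (intro DERIV_chain2[of displacement] DERIV_cmult deriv_cos_turn) simp
  then show ?thesis unfolding loop_log_def[abs_def]
    by (auto intro!: derivative_eq_intros)
qed

definition loop_velocity :: "real \<Rightarrow> real \<Rightarrow> real \<Rightarrow> real \<times> real" where
  "loop_velocity L R u = (let l = loop_log L R u;
      l' = - (2 * pi * R * sin (2 * pi * u) * disp_deriv 1 (R * cos (2 * pi * u)))
    in (exp l * l', - R * (2 * pi * cos (2 * pi * u)) * (G 0 l * exp (- l))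
         - R * sin (2 * pi * u) * (G 1 l * l' * exp (- l) - G 0 l * exp (- l) * l')))"

lemma level_loop_deriv: "(level_loop L R has_vector_derivative loop_velocity L R u) (at u)"
proof -
  define l' where "l' = - (2 * pi * R * sin (2 * pi * u) * disp_deriv 1 (R * cos (2 * pi * u)))"
  have l: "(loop_log L R has_real_derivative l') (at u)" unfolding l'_def by (rule loop_log_deriv)
  have 1: "((\<lambda>u. exp (loop_log L R u)) has_real_derivative exp (loop_log L R u) * l') (at u)"
    by (auto intro!: derivative_eq_intros l)
  have g: "((\<lambda>u. G 0 (loop_log L R u)) has_real_derivative G 1 (loop_log L R u) * l') (at u)"
    by (rule DERIV_chain2[OF G_derivs(1) l])
  have 2: "((\<lambda>u. - R * sin (2 * pi * u) * (G 0 (loop_log L R u) * exp (- loop_log L R u)))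
      has_real_derivative
     (- R * (2 * pi * cos (2 * pi * u)) * (G 0 (loop_log L R u) * exp (- loop_log L R u))
         - R * sin (2 * pi * u) * (G 1 (loop_log L R u) * l' * exp (- loop_log L R u) - G 0
         (loop_log L R u) * exp (- loop_log L R u) * l'))) (at u)"
    by (auto intro!: derivative_eq_intros l g simp: algebra_simps)
  show ?thesis
    unfolding level_loop_def[abs_def] loop_velocity_def Let_def l'_def[symmetric]
    using 1 2 by (intro has_vector_derivative_Pair) (simp_all add:
        has_real_derivative_iff_has_vector_derivative)
qed

lemma continuous_on_loop_velocity: "continuous_on S (loop_velocity L R)"
proof -
  have l: "continuous_on S (loop_log L R)"
    by (intro continuous_at_imp_continuous_on ballI DERIV_isCont[OF loop_log_deriv])
  show ?thesis unfolding loop_velocity_def[abs_def] Let_def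
    by (intro continuous_intros l continuous_on_compose2[OF continuous_disp_deriv]
        continuous_on_compose2[OF G_cont l]) auto
qed

lemma valid_path_level_loop: "valid_path (level_loop L R)"
  unfolding valid_path_def
  by (rule C1_differentiable_imp_piecewise)
     (auto simp: C1_differentiable_on_def intro!: exI[of _ "loop_velocity L R"]
       level_loop_deriv continuous_on_loop_velocity)

lemma closed_path_level_loop: "closed_path (level_loop L R)"
  by (simp add: closed_path_def level_loop_def loop_log_def)

lemma simple_path_level_loop:
  assumes "R > 0" shows "simple_path (level_loop L R)"
  unfolding simple_path_def loop_free_def
proof (intro conjI ballI impI)
  show "path (level_loop L R)" by (rule valid_path_imp_path[OF valid_path_level_loop])
  fix u v :: real
  assume uv: "u \<in> {0..1}" "v \<in> {0..1}" and eq: "level_loop L R u = level_loop L R v"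
  then have l: "loop_log L R u = loop_log L R v" by (simp add: level_loop_def)
  then have "displacement (R * cos (2 * pi * u)) = displacement (R * cos (2 * pi * v))"
    by (simp add: loop_log_def)
  then have "R * cos (2 * pi * u) = R * cos (2 * pi * v)" by (metis amplitude_displacement)
  with assms have c: "cos (2 * pi * u) = cos (2 * pi * v)" by simp
  have "R * sin (2 * pi * u) * (G 0 (loop_log L R v) * exp (- loop_log L R v)) =
      R * sin (2 * pi * v) * (G 0 (loop_log L R v) * exp (- loop_log L R v))"
    using eq by (simp add: level_loop_def l)
  then have "sin (2 * pi * u) = sin (2 * pi * v)"
    using assms G_pos[of "loop_log L R v"] by simp
  with c obtain n :: int where n: "2 * pi * u = 2 * pi * v + 2 * pi * n"
    using sin_cos_eq_iff by blast
  then have "2 * pi * u = 2 * pi * (v + n)" by (simp add: algebra_simps)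
  then have un: "u = v + n" by simp
  with uv have "- 1 \<le> n" "n \<le> 1" by auto
  then have "n = - 1 \<or> n = 0 \<or> n = 1" by linarith
  with un uv show "u = v \<or> u = 0 \<and> v = 1 \<or> u = 1 \<and> v = 0" by auto
qed

lemma level_loop_integral:
  assumes "R \<ge> 0"
  shows "((\<lambda>u. snd (level_loop L R u) * fst (vector_derivative (level_loop L R) (at u within {0..1})))
    has_integral 2 * pi * act 0 (R\<^sup>2) L) {0..1}"
proof -
  have I: "((\<lambda>u. 2 * pi * R\<^sup>2 * (sin (2 * pi * u) ^ 2 * weight 0 L (R * cos (2 * pi * u)))) has_integral
     2 * pi * R\<^sup>2 * circle_average 2 (weight 0 L) R) {0..1}"
    by (intro has_integral_mult_right has_integral_circle_average continuous_on_section
        weight_cont) simp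
  have E: "2 * pi * R\<^sup>2 * (sin (2 * pi * u) ^ 2 * weight 0 L (R * cos (2 * pi * u))) =
      snd (level_loop L R u) * fst (vector_derivative (level_loop L R) (at u within {0..1}))" if
      "u \<in> {0..1}" for u
  proof -
    have vd: "vector_derivative (level_loop L R) (at u within {0..1}) = loop_velocity L R u"
      using that by (intro vector_derivative_at_within_ivl level_loop_deriv) auto
    have "exp (- loop_log L R u) * exp (loop_log L R u) = 1" by (simp add: exp_minus)
    then show ?thesis
      unfolding vd level_loop_def loop_velocity_def Let_def weight_def fst_conv snd_conv
          loop_log_def[symmetric]
      by (simp add: power2_eq_square)
  qed
  have "2 * pi * act 0 (R\<^sup>2) L = 2 * pi * R\<^sup>2 * circle_average 2 (weight 0 L) R"
    using assms by (simp add: act_def)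
  then show ?thesis using has_integral_eq[OF E I] by (simp only:)
qed

end

section \<open>Flat metrics in flat coordinates\<close>

lemma matrix_inv_inverse:
  fixes A :: "real^'n^'n"
  assumes "det A \<noteq> 0" shows "A ** matrix_inv A = mat 1" "matrix_inv A ** A = mat 1"
proof -
  have "\<exists>A'. A ** A' = mat 1 \<and> A' ** A = mat 1"
    using assms invertible_det_nz[of A] unfolding invertible_def by blast
  from someI_ex[OF this] show "A ** matrix_inv A = mat 1" "matrix_inv A ** A = mat 1"
    by (auto simp: matrix_inv_def)
qed

lemma matrix_inv_mult_vector:
  fixes A :: "real^'n^'n"
  assumes "det A \<noteq> 0" shows "matrix_inv A *v v = w \<longleftrightarrow> A *v w = v"
proof -
  have "A *v (matrix_inv A *v v) = v" "matrix_inv A *v (A *v w) = w"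
    using matrix_inv_inverse[OF assms] by (simp_all add: matrix_vector_mul_assoc)
  then show ?thesis by auto
qed

lemma positive_definite_det:
  fixes A :: "real^'n^'n"
  assumes "\<And>v. v \<noteq> 0 \<Longrightarrow> v \<bullet> (A *v v) > 0" shows "det A \<noteq> 0"
  using assms by (intro det_nonzero_if_injective) (metis inner_zero_right less_irrefl)

lemma positive_definite_matrix_inv:
  fixes A :: "real^'n^'n"
  assumes pos: "\<And>v. v \<noteq> 0 \<Longrightarrow> v \<bullet> (A *v v) > 0" and "p \<noteq> 0"
  shows "p \<bullet> (matrix_inv A *v p) > 0"
proof -
  define w where "w = matrix_inv A *v p"
  have "A *v w = p" using matrix_inv_mult_vector[OF positive_definite_det[OF pos]] w_def by blast
  with pos[of w] assms(2) show ?thesis by (cases "w = 0") (auto simp: w_def inner_commute)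
qed

text \<open>
  By positivity of \<open>g\<close> the Jacobian of the chart is invertible. Hence the constant matrix of the
  metric inherits symmetry and positivity from \<open>g\<close> at any one point, and its inverse is the dual
  metric in the momenta of the chart.
\<close>

lemma flat_chart_metric:
  fixes g :: "real^'n \<Rightarrow> real^'n^'n"
  assumes chart: "flat_chart g W \<phi>" and q0: "q0 \<in> W" and g: "riemannian_metric_on_torus g"
  obtains B where "inverse_metric B"
    "\<And>q. q \<in> W \<Longrightarrow> det (jacobian \<phi> (at q)) \<noteq> 0"
    "\<And>q P. q \<in> W \<Longrightarrow> conorm_sq g q (transpose (jacobian \<phi> (at q)) *v P) = P \<bullet> (B *v P)"
proof -
  obtain A where A: "\<And>q. q \<in> W \<Longrightarrow> g q = transpose (jacobian \<phi> (at q)) ** A ** jacobian \<phi> (at q)"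
    using chart unfolding flat_chart_def by blast
  have gsym: "transpose (g q) = g q" and gpos: "v \<noteq> 0 \<Longrightarrow> v \<bullet> (g q *v v) > 0" for q v
    using g unfolding riemannian_metric_on_torus_def by blast+
  have form: "u \<bullet> (g q *v v) = (jacobian \<phi> (at q) *v u) \<bullet> (A *v (jacobian \<phi> (at q) *v v))" if "q \<in>
      W" for q u v
    unfolding A[OF that]
    by (metis dot_lmul_matrix inner_commute matrix_vector_mul_assoc transpose_matrix_vector)
  have detJ: "det (jacobian \<phi> (at q)) \<noteq> 0" if "q \<in> W" for q
  proof (rule det_nonzero_if_injective)
    fix v assume "jacobian \<phi> (at q) *v v = 0"
    then have "v \<bullet> (g q *v v) = 0" using form[OF that, of v v] by simp
    then show "v = 0" using gpos[of v q] by (cases "v = 0") auto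
  qed
  define J where "J = jacobian \<phi> (at q0)"
  have surj: "\<exists>u. J *v u = w" for w
    using matrix_inv_mult_vector[OF detJ[OF q0, folded J_def]] by blast
  have Apos: "w \<bullet> (A *v w) > 0" if w: "w \<noteq> 0" for w
  proof -
    obtain u where u: "J *v u = w" using surj by blast
    with w have "u \<noteq> 0" by auto
    with gpos[of u q0] show ?thesis unfolding form[OF q0] J_def[symmetric] u .
  qed
  have Asym: "u \<bullet> (A *v v) = v \<bullet> (A *v u)" for u v
  proof -
    obtain u' v' where uv: "J *v u' = u" "J *v v' = v" using surj by blast
    have "u' \<bullet> (g q0 *v v') = v' \<bullet> (g q0 *v u')"
      by (metis dot_lmul_matrix gsym inner_commute vector_transpose_matrix)
    then show ?thesis unfolding form[OF q0] J_def[symmetric] uv .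
  qed
  define B where "B = matrix_inv A"
  have detA: "det A \<noteq> 0" using Apos by (rule positive_definite_det)
  have AB: "A *v (B *v v) = v" for v using matrix_inv_mult_vector[OF detA] B_def by blast
  have "inverse_metric B"
  proof
    show "v \<bullet> (B *v v) > 0" if "v \<noteq> 0" for v
      unfolding B_def using Apos that by (rule positive_definite_matrix_inv)
    have "u \<bullet> (B *v v) = (B *v u) \<bullet> v" for u v
      using Asym[of "B *v u" "B *v v"] by (simp add: AB inner_commute)
    then have "u \<bullet> (B *v v) = u \<bullet> (transpose B *v v)" for u v
      by (metis dot_lmul_matrix inner_commute transpose_matrix_vector)
    then have "B *v v = transpose B *v v" for v by (metis vector_eq_rdot inner_commute)
    then show "transpose B = B" by (metis matrix_eq)
  qed
  moreover have "conorm_sq g q (transpose (jacobian \<phi> (at q)) *v P) = P \<bullet> (B *v P)" if q: "q \<in> W"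
      for q P
  proof -
    define K where "K = jacobian \<phi> (at q)"
    obtain w where w: "K *v w = B *v P"
      using matrix_inv_mult_vector[OF detJ[OF q, folded K_def]] by blast
    have "g q *v w = transpose K *v P"
      unfolding A[OF q] K_def[symmetric]
      by (simp only: matrix_vector_mul_assoc[symmetric] w AB)
    then have "matrix_inv (g q) *v (transpose K *v P) = w"
      using matrix_inv_mult_vector[OF positive_definite_det[OF gpos]] by blast
    then have "conorm_sq g q (transpose K *v P) = (transpose K *v P) \<bullet> w" by (simp add: conorm_sq_def)
    also have "\<dots> = P \<bullet> (K *v w)" by (simp add: dot_lmul_matrix)
    finally show ?thesis unfolding w by (simp only: K_def)
  qed
  ultimately show thesis using detJ that by blast
qed

lemma continuous_on_det:
  fixes M :: "'a::topological_space \<Rightarrow> real^'n^'n"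
  assumes "\<And>i j. continuous_on S (\<lambda>x. M x $ i $ j)"
  shows "continuous_on S (\<lambda>x. det (M x))"
  unfolding det_def by (intro continuous_intros assms)

text \<open>
  By Cramer's rule the inverse matrix depends continuously on the metric.
\<close>

lemma continuous_on_conorm_sq:
  fixes g :: "real^'n \<Rightarrow> real^'n^'n"
  assumes g: "riemannian_metric_on_torus g"
  shows "continuous_on S (\<lambda>(q, p). conorm_sq g q p)"
proof -
  have gpos: "v \<noteq> 0 \<Longrightarrow> v \<bullet> (g q *v v) > 0" for q v
    using g unfolding riemannian_metric_on_torus_def by blast
  have det: "det (g q) \<noteq> 0" for q by (rule positive_definite_det[OF gpos])
  have gc: "continuous_on UNIV (\<lambda>q. g q $ i $ j)" for i j
  proof -
    have "Cr_on (real 0) UNIV (\<lambda>q. g q $ i $ j)"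
      using g unfolding riemannian_metric_on_torus_def smooth_fun_on_def by blast
    then show ?thesis by (simp add: Cr_on_def)
  qed
  have gc': "continuous_on S (\<lambda>z. g (fst z) $ i $ j)" for i j and S :: "((real^'n) \<times> (real^'n)) set"
    by (rule continuous_on_compose2[OF gc]) (auto intro!: continuous_intros)
  have inv: "conorm_sq g q p = p \<bullet> (\<chi> k. det (\<chi> i j. if j = k then p $ i else g q $ i $ j) / det
      (g q))" for q p
  proof -
    have "g q *v (matrix_inv (g q) *v p) = p" using matrix_inv_mult_vector[OF det[of q]] by blast
    from cramer[OF det[of q], THEN iffD1, OF this] show ?thesis by (simp only: conorm_sq_def)
  qed
  have "continuous_on S (\<lambda>z. if j = k then snd z $ i else g (fst z) $ i $ j)" for i j k
    by (cases "j = k") (auto intro!: continuous_intros gc')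
  then have D: "continuous_on S (\<lambda>z. det (\<chi> i j. if j = k then snd z $ i else g (fst z) $ i $ j))" for k
    by (intro continuous_on_det) (simp only: vec_lambda_beta)
  have "continuous_on S (\<lambda>z. det (g (fst z)))" by (intro continuous_on_det gc')
  then have "continuous_on S (\<lambda>z. snd z \<bullet> (\<chi> k. det (\<chi> i j. if j = k then snd z $ i else g (fst z)
      $ i $ j) / det (g (fst z))))"
    using det by (intro continuous_on_inner continuous_on_vec_lambda continuous_on_divide D
        continuous_on_snd continuous_on_id) auto
  then show ?thesis unfolding case_prod_unfold inv .
qed

section \<open>The thermostat with a fixed momentum\<close>

locale thermostat =
  fixes \<Omega> :: "real \<Rightarrow> real" and c :: real
  assumes Omega_pos: "s > 0 \<Longrightarrow> \<Omega> s > 0" and Omega_C4: "C_on 4 {0<..} \<Omega>" and c_pos: "c > 0"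
begin

text \<open>
  The function \<open>G\<close> of the introduction.
\<close>

definition inverse_mass_weight :: "real \<Rightarrow> real" where
  "inverse_mass_weight l = exp l * sqrt (2 * c * inverse (\<Omega> (exp l)))"

abbreviation G :: "nat \<Rightarrow> real \<Rightarrow> real" where
  "G i \<equiv> (deriv ^^ i) inverse_mass_weight"

lemma C_on_inverse_mass_weight: "C_on 4 UNIV inverse_mass_weight"
  unfolding inverse_mass_weight_def[abs_def] using Omega_pos c_pos
  by (intro C_on_mult C_on_exp C_on_compose[OF C_on_sqrt C_on_mult[OF C_on_const
        C_on_compose[OF C_on_inverse C_on_compose[OF Omega_C4 C_on_exp]]]]) auto

sublocale oscillator G
proof
  show "((deriv ^^ i) inverse_mass_weight has_real_derivative (deriv ^^ Suc i) inverse_mass_weight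
      x) (at x)" if "i < 4" for i x
    by (rule C_on_has_iterated_deriv[OF C_on_inverse_mass_weight that])
  show "continuous_on UNIV ((deriv ^^ 4) inverse_mass_weight)"
    by (rule C_on_continuous[OF C_on_iterated_deriv[OF C_on_inverse_mass_weight order_refl]])
  show "(deriv ^^ 0) inverse_mass_weight x > 0" for x
    using Omega_pos[of "exp x"] c_pos by (simp add: inverse_mass_weight_def)
qed

text \<open>
  \<open>F\<^sub>0\<close> with the squared norm \<open>N\<close> of \<open>p\<close> as a parameter.
\<close>

definition radial_energy :: "real \<Rightarrow> real \<Rightarrow> real \<Rightarrow> real" where
  "radial_energy N s y = N / (2 * s\<^sup>2) + \<Omega> s * y\<^sup>2 / 2 + c * ln s"

definition size_log :: "real \<Rightarrow> real" where
  "size_log N = ln (N / c) / 2"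

lemma radial_energy_eq:
  assumes "N > 0" "s > 0"
  shows "radial_energy N s y =
    c * (size_log N + 1 / 2 + (amplitude (ln s - size_log N))\<^sup>2) + \<Omega> s * y\<^sup>2 / 2"
proof -
  have "exp (- 2 * (ln s - size_log N)) = exp (2 * size_log N) / exp (2 * ln s)"
    by (simp add: algebra_simps exp_diff)
  also have "exp (2 * size_log N) = N / c" using assms c_pos by (simp add: size_log_def)
  also have "exp (2 * ln s) = s\<^sup>2" using assms by (simp add: exp_double)
  finally have e: "exp (- 2 * (ln s - size_log N)) = N / c / s\<^sup>2" .
  show ?thesis
    unfolding amplitude_square e radial_energy_def using assms c_pos by (simp add: field_simps)
qed

definition excess_energy :: "real \<Rightarrow> real \<Rightarrow> real \<Rightarrow> real" where
  "excess_energy N s y = radial_energy N s y / c - size_log N - 1 / 2"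

lemma excess_energy_eq:
  assumes "N > 0" "s > 0"
  shows "excess_energy N s y = (amplitude (ln s - size_log N))\<^sup>2 + \<Omega> s * y\<^sup>2 / (2 * c)"
  unfolding excess_energy_def radial_energy_eq[OF assms] using c_pos by (simp add: field_simps)

lemma excess_energy_nonneg: "N > 0 \<Longrightarrow> s > 0 \<Longrightarrow> excess_energy N s y \<ge> 0"
  using Omega_pos[of s] c_pos by (simp add: excess_energy_eq)

lemma G_exp_minus: "G 0 l * exp (- l) = sqrt (2 * c * inverse (\<Omega> (exp l)))"
  by (simp add: inverse_mass_weight_def mult.commute mult.left_commute exp_minus field_simps)

text \<open>
  The excess energy is a sum of two squares, the amplitude and the rescaled momentum, and the
  loop traverses the circle that these coordinates describe.
\<close>

lemma path_image_level_loop: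
  assumes N: "N > 0" and R: "R \<ge> 0"
  shows "path_image (level_loop (size_log N) R) = {(x, y). x > 0 \<and> excess_energy N x y = R\<^sup>2}"
proof (intro set_eqI iffI)
  fix z assume "z \<in> path_image (level_loop (size_log N) R)"
  then obtain u where u: "z = level_loop (size_log N) R u" by (auto simp: path_image_def)
  let ?l = "loop_log (size_log N) R u"
  have "\<Omega> (exp ?l) > 0" by (rule Omega_pos) simp
  then have "(sqrt (2 * c * inverse (\<Omega> (exp ?l))))\<^sup>2 = 2 * c * inverse (\<Omega> (exp ?l))"
    using c_pos by simp
  then have "excess_energy N (fst z) (snd z) = (R * cos (2 * pi * u))\<^sup>2 + (R * sin (2 * pi * u))\<^sup>2"
    using \<open>\<Omega> (exp ?l) > 0\<close> c_pos
    unfolding u level_loop_def fst_conv snd_conv excess_energy_eq[OF N exp_gt_zero] G_exp_minus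
    by (simp add: power_mult_distrib) (simp add: loop_log_def field_simps)
  also have "\<dots> = R\<^sup>2 * ((cos (2 * pi * u))\<^sup>2 + (sin (2 * pi * u))\<^sup>2)"
    by (simp only: power_mult_distrib distrib_left)
  finally have "excess_energy N (fst z) (snd z) = R\<^sup>2" by simp
  moreover have "fst z > 0" by (simp add: u level_loop_def)
  ultimately show "z \<in> {(x, y). x > 0 \<and> excess_energy N x y = R\<^sup>2}" by (simp add: case_prod_beta)
next
  fix z assume "z \<in> {(x, y). x > 0 \<and> excess_energy N x y = R\<^sup>2}"
  then obtain x y where z: "z = (x, y)" and x: "x > 0" and e: "excess_energy N x y = R\<^sup>2" by auto
  define k where "k = sqrt (2 * c * inverse (\<Omega> x))"
  define a b where ab: "a = amplitude (ln x - size_log N)" "b = y / k"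
  have k: "k > 0" "k\<^sup>2 = 2 * c / \<Omega> x"
    using Omega_pos[OF x] c_pos by (simp_all add: k_def divide_inverse)
  have sum: "a\<^sup>2 + b\<^sup>2 = R\<^sup>2"
    using e Omega_pos[OF x] c_pos unfolding excess_energy_eq[OF N x] ab power_divide k(2)
    by (simp add: field_simps)
  obtain u where u: "u \<in> {0..1}" "a = R * cos (2 * pi * u)" "b = - R * sin (2 * pi * u)"
  proof (cases "R = 0")
    case True
    with sum have "a = 0" "b = 0" by (simp_all add: sum_power2_eq_zero_iff)
    with True that[of 0] show thesis by simp
  next
    case False
    with sum have "(a / R)\<^sup>2 + (- b / R)\<^sup>2 = 1"
      by (simp add: power_divide add_divide_distrib[symmetric])
    from sincos_total_2pi[OF this] obtain t where t: "0 \<le> t" "t < 2 * pi" "a / R = cos t" "- b / R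
        = sin t" .
    show thesis
    proof (rule that[of "t / (2 * pi)"])
      show "t / (2 * pi) \<in> {0..1}" using t by (simp add: field_simps)
      show "a = R * cos (2 * pi * (t / (2 * pi)))" "b = - R * sin (2 * pi * (t / (2 * pi)))"
        using t False by (simp_all add: field_simps)
    qed
  qed
  have "loop_log (size_log N) R u = ln x"
    unfolding loop_log_def u(2)[symmetric] ab by simp
  then have "level_loop (size_log N) R u = (x, b * k)"
    unfolding level_loop_def G_exp_minus using x by (simp add: u(3) k_def)
  then have "level_loop (size_log N) R u = z" using k(1) by (simp add: z ab)
  with u(1) show "z \<in> path_image (level_loop (size_log N) R)" by (auto simp: path_image_def)
qed

text \<open>
  At the minimum \<open>R = 0\<close>, the loop is constant and the level curve is a point.
\<close>

lemma thermostat_action_radial: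
  assumes F: "\<And>x y. x > 0 \<Longrightarrow> F (x, q, y, p) = radial_energy N x y" and N: "N > 0" and s: "s > 0"
  shows "thermostat_action F (s, q, ps, p) (act 0 (excess_energy N s ps) (size_log N))"
proof -
  define R where "R = sqrt (excess_energy N s ps)"
  have R: "R \<ge> 0" "R\<^sup>2 = excess_energy N s ps"
    using excess_energy_nonneg[OF N s] by (simp_all add: R_def)
  have img: "path_image (level_loop (size_log N) R) = level_curve F (s, q, ps, p)"
    unfolding path_image_level_loop[OF N R(1)] R(2) excess_energy_def
    using F c_pos s by auto
  have "act 0 (R\<^sup>2) (size_log N) \<ge> 0"
    using act_strict_mono[of 0 "R\<^sup>2" "size_log N"] by (cases "R = 0") (auto simp: act_at_0(1))
  moreover have "simple_path (level_loop (size_log N) R) \<or> (\<exists>c. level_curve F (s, q, ps, p) = {c})"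
  proof (cases "R = 0")
    case True
    then have "path_image (level_loop (size_log N) R) = {(exp (size_log N), 0)}"
      by (simp add: path_image_def level_loop_def loop_log_def image_constant_conv)
    then show ?thesis unfolding img by blast
  next
    case False
    with R(1) show ?thesis using simple_path_level_loop[of R] by simp
  qed
  ultimately show ?thesis
    unfolding thermostat_action_def R(2)[symmetric]
    using valid_path_level_loop closed_path_level_loop img level_loop_integral[OF R(1)] by blast
qed

end

section \<open>Non-degeneracy near the equilibria\<close>

locale torus_thermostat = thermostat \<Omega> c for \<Omega> :: "real \<Rightarrow> real" and c :: real +
  fixes g :: "real^'n::finite \<Rightarrow> real^'n^'n" and F :: "'n phase \<Rightarrow> real"
  assumes metric: "riemannian_metric_on_torus g"
    and F: "s > 0 \<Longrightarrow> F (s, q, ps, p) = radial_energy (conorm_sq g q p) s ps"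
begin

lemma metric_pos: "v \<noteq> 0 \<Longrightarrow> v \<bullet> (g q *v v) > 0"
  using metric unfolding riemannian_metric_on_torus_def by blast

lemma conorm_sq_pos: "p \<noteq> 0 \<Longrightarrow> conorm_sq g q p > 0"
  unfolding conorm_sq_def by (rule positive_definite_matrix_inv[OF metric_pos])

lemma conorm_sq_scale: "conorm_sq g q (r *\<^sub>R p) = r\<^sup>2 * conorm_sq g q p"
  by (simp add: conorm_sq_def matrix_vector_mult_scaleR power2_eq_square)

fun size_at :: "'n phase \<Rightarrow> real" where
  "size_at (s, q, ps, p) = size_log (conorm_sq g q p)"

fun excess_at :: "'n phase \<Rightarrow> real" where
  "excess_at (s, q, ps, p) = excess_energy (conorm_sq g q p) s ps"

definition moving_points :: "'n phase set" where
  "moving_points = {(s, q, ps, p). s > 0 \<and> p \<noteq> 0}"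

text \<open>
  Points of this set have \<open>A > 0\<close>, so that only derivatives at interior points are involved.
\<close>

definition nondegenerate_region :: "'n phase set" where
  "nondegenerate_region = {z \<in> moving_points. excess_at z > 0
     \<and> act_t 0 (excess_at z) (size_at z) - act 1 (excess_at z) (size_at z) > 0
     \<and> kol_det (excess_at z) (size_at z) \<noteq> 0 \<and> iso_det (excess_at z) (size_at z) \<noteq> 0}"

lemma open_moving_points: "open moving_points"
proof -
  have eq: "moving_points = {z. fst z > 0} \<inter> {z. snd (snd (snd z)) \<noteq> 0}" by (auto simp:
      moving_points_def)
  show ?thesis unfolding eq
    by (intro open_Int open_Collect_less open_Collect_neq continuous_intros)
qed

lemma continuous_on_size_at: "continuous_on moving_points size_at"
  and continuous_on_excess_at: "continuous_on moving_points excess_at"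
proof -
  have N: "continuous_on moving_points (\<lambda>z. conorm_sq g (fst (snd z)) (snd (snd (snd z))))"
  proof -
    have "continuous_on moving_points (\<lambda>z. (\<lambda>(q, p). conorm_sq g q p) (fst (snd z), snd (snd (snd z))))"
      by (rule continuous_on_compose2[OF continuous_on_conorm_sq[OF metric, of UNIV]]) (auto
          intro!: continuous_intros)
    then show ?thesis by simp
  qed
  have Npos: "conorm_sq g (fst (snd z)) (snd (snd (snd z))) > 0" and s: "fst z > 0" if "z \<in>
      moving_points" for z
    using that conorm_sq_pos by (auto simp: moving_points_def)
  have "size_at = (\<lambda>z. ln (conorm_sq g (fst (snd z)) (snd (snd (snd z))) / c) / 2)"
    by (auto simp: size_log_def)
  then show L: "continuous_on moving_points size_at"
    using c_pos Npos by (simp only:) (intro continuous_intros N; force)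
  have "continuous_on moving_points (\<lambda>z. \<Omega> (fst z))"
    by (rule continuous_on_compose2[OF C_on_continuous[OF Omega_C4]]) (auto intro!: continuous_intros s)
  moreover have "excess_at = (\<lambda>z. (conorm_sq g (fst (snd z)) (snd (snd (snd z))) / (2 * (fst z)\<^sup>2)
      + \<Omega> (fst z) * (fst (snd (snd z)))\<^sup>2 / 2 + c * ln (fst z)) / c - size_at z - 1 / 2)"
    by (auto simp: excess_energy_def radial_energy_def)
  ultimately show "continuous_on moving_points excess_at"
    using c_pos s by (simp only:) (intro continuous_intros N L; force)
qed

lemma open_nondegenerate_region: "open nondegenerate_region"
proof -
  have *: "open (moving_points \<inter> f -` S)" if "continuous_on moving_points f" "open S" for f :: "'n
      phase \<Rightarrow> real" and S
    using that open_moving_points by (intro continuous_open_preimage)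
  have "nondegenerate_region = (moving_points \<inter> excess_at -` {0<..})
     \<inter> (moving_points \<inter> (\<lambda>z. act_t 0 (excess_at z) (size_at z) - act 1 (excess_at z) (size_at z))
     -` {0<..})
     \<inter> ((moving_points \<inter> (\<lambda>z. kol_det (excess_at z) (size_at z)) -` (- {0}))
     \<inter> (moving_points \<inter> (\<lambda>z. iso_det (excess_at z) (size_at z)) -` (- {0})))"
    by (auto simp: nondegenerate_region_def)
  then show ?thesis
    by (simp only:)
       (intro open_Int * continuous_on_diff continuous_on_act continuous_on_dets
          continuous_on_size_at continuous_on_excess_at; auto)
qed

lemma phase_open_nondegenerate_region: "phase_open nondegenerate_region"
proof -
  have per: "g (q + m) = g q" if "\<forall>i. m $ i \<in> \<int>" for q m
    using metric that unfolding riemannian_metric_on_torus_def lattice_periodic_def by blast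
  have "((s, q + m, ps, p) \<in> nondegenerate_region) = ((s, q, ps, p) \<in> nondegenerate_region)" if
      "\<forall>i. m $ i \<in> \<int>" for s q m ps p
    by (simp add: nondegenerate_region_def moving_points_def conorm_sq_def per[OF that])
  then show ?thesis
    using open_nondegenerate_region
    by (auto simp: phase_open_def lattice_periodic_def nondegenerate_region_def moving_points_def
        phase_space_def)
qed

lemma equilibriumD:
  assumes "(s, q, ps, p) \<in> thermostatic_equilibria F"
  shows "s > 0" "ps = 0" "conorm_sq g q p = c * s\<^sup>2"
proof -
  from assms obtain dq dp where s: "s > 0"
    and d: "(F has_derivative symplectic_form (0, dq, 0, dp)) (at (s, q, ps, p))"
    by (auto simp: thermostatic_equilibria_def phase_space_def hamiltonian_vector_at_def)
  show "s > 0" by (rule s)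
  have "((\<lambda>y. (s, q, y, p)) has_derivative (\<lambda>h. (0, 0, h, 0))) (at ps)"
    by (auto intro!: derivative_eq_intros)
  from has_derivative_compose[OF this d] have "((\<lambda>y. F (s, q, y, p)) has_derivative (\<lambda>h. 0)) (at
      ps)" by simp
  then have "((\<lambda>y. F (s, q, y, p)) has_real_derivative 0) (at ps)"
    by (simp add: has_field_derivative_def lambda_zero)
  moreover have "((\<lambda>y. F (s, q, y, p)) has_real_derivative \<Omega> s * ps) (at ps)"
    unfolding F[OF s] radial_energy_def by (auto intro!: derivative_eq_intros)
  ultimately have "\<Omega> s * ps = 0" by (rule DERIV_unique[symmetric])
  with Omega_pos[OF s] show ps: "ps = 0" by simp
  have "((\<lambda>x. (x, q, ps, p)) has_derivative (\<lambda>h. (h, 0, 0, 0))) (at s)"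
    by (auto intro!: derivative_eq_intros simp: zero_prod_def)
  from has_derivative_compose[OF this d] have "((\<lambda>x. F (x, q, ps, p)) has_derivative (\<lambda>h. 0)) (at
      s)" by simp
  then have "((\<lambda>x. F (x, q, ps, p)) has_real_derivative 0) (at s)"
    by (simp add: has_field_derivative_def lambda_zero)
  moreover have "((\<lambda>x. F (x, q, ps, p)) has_real_derivative c / s - conorm_sq g q p / s ^ 3) (at s)"
  proof (rule has_field_derivative_transform_within_open[where S = "{0<..}"])
    show "((\<lambda>x. conorm_sq g q p / (2 * x\<^sup>2) + c * ln x) has_real_derivative c / s - conorm_sq g q
        p / s ^ 3) (at s)"
      using s by (auto intro!: derivative_eq_intros simp: field_simps power2_eq_square power3_eq_cube)
  qed (use s F in \<open>auto simp: ps radial_energy_def\<close>)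
  ultimately have "c / s - conorm_sq g q p / s ^ 3 = 0" by (rule DERIV_unique[symmetric])
  with s show "conorm_sq g q p = c * s\<^sup>2" by (simp add: field_simps power2_eq_square power3_eq_cube)
qed

text \<open>
  Given an equilibrium and \<open>(t, L)\<close>, rescale \<open>s\<close> and \<open>p\<close> by the same factor to attain the size
  \<open>L\<close> while staying at the bottom of the well, and then choose \<open>p\<^sub>s\<close> to attain the excess energy
  \<open>t\<close>. This depends continuously on \<open>(t, L)\<close>, and \<open>nondegenerate_near_0\<close> supplies suitable
  values.
\<close>

lemma equilibria_in_closure: "thermostatic_equilibria F \<subseteq> closure nondegenerate_region"
proof
  fix z assume z: "z \<in> thermostatic_equilibria F"
  obtain s q ps p where zeq: "z = (s, q, ps, p)" by (metis prod_cases4)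
  from z zeq have s: "s > 0" and ps: "ps = 0" and N: "conorm_sq g q p = c * s\<^sup>2"
    using equilibriumD by blast+
  have p: "p \<noteq> 0" using N s c_pos by (auto simp: conorm_sq_def)
  define L0 where "L0 = ln s"
  define w where "w = (\<lambda>(t, L). (s * exp (L - L0), q, sqrt (2 * c * t * inverse (\<Omega> (s * exp (L -
      L0)))), exp (L - L0) *\<^sub>R p))"
  have w0: "w (0, L0) = z" by (simp add: w_def zeq ps)
  have size_w: "size_at (w (t, L)) = L" for t L
  proof -
    have "(exp (L - L0))\<^sup>2 * (c * s\<^sup>2) / c = (exp L)\<^sup>2"
      using s c_pos by (simp add: exp_diff L0_def power_divide)
    then have "size_at (w (t, L)) = ln ((exp L)\<^sup>2) / 2" by (simp add: w_def size_log_def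
        conorm_sq_scale N)
    then show ?thesis by (simp add: ln_realpow)
  qed
  have excess_w: "excess_at (w (t, L)) = t" if "t \<ge> 0" for t L
  proof -
    have s': "s * exp (L - L0) > 0" using s by simp
    have "ln (s * exp (L - L0)) = L" using s by (simp add: ln_mult L0_def)
    moreover have "conorm_sq g q (exp (L - L0) *\<^sub>R p) > 0" using p by (intro conorm_sq_pos) simp
    moreover have "size_log (conorm_sq g q (exp (L - L0) *\<^sub>R p)) = L"
      using size_w[of t L] by (simp add: w_def)
    ultimately show ?thesis
      using that c_pos Omega_pos[OF s'] s'
      by (simp add: w_def excess_energy_eq amplitude_def field_simps)
  qed
  have cw: "continuous (at (0, L0)) w"
  proof -
    have "continuous_on UNIV (\<lambda>z :: real \<times> real. \<Omega> (s * exp (snd z - L0)))"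
      by (rule continuous_on_compose2[OF C_on_continuous[OF Omega_C4]])
         (use s in \<open>auto intro!: continuous_intros\<close>)
    moreover have "\<Omega> (s * exp (snd z - L0)) \<noteq> 0" for z :: "real \<times> real"
      using Omega_pos[of "s * exp (snd z - L0)"] s by simp
    ultimately have "continuous_on UNIV w"
      unfolding w_def case_prod_unfold by (intro continuous_intros) auto
    then show ?thesis by (simp add: continuous_on_eq_continuous_at)
  qed
  show "z \<in> closure nondegenerate_region"
    unfolding closure_approachable
  proof (intro allI impI)
    fix e :: real assume "e > 0"
    with cw obtain d where d: "d > 0" "\<And>x. dist x (0, L0) < d \<Longrightarrow> dist (w x) z < e"
      unfolding continuous_at_eps_delta w0 by blast
    from nondegenerate_near_0[of "d / 2" L0] d(1) obtain L where L: "\<bar>L - L0\<bar> < d / 2"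
      and ev: "eventually (\<lambda>t. iso_det t L \<noteq> 0 \<and> kol_det t L \<noteq> 0 \<and> act_t 0 t L - act 1 t L > 0)
      (at_right 0)"
      by auto
    have "eventually (\<lambda>t. 0 < t \<and> t < d / 2) (at_right (0::real))"
      using d(1) by (auto simp: eventually_at_right_field intro!: exI[of _ "d / 2"])
    with ev have "eventually (\<lambda>t. (0 < t \<and> t < d / 2) \<and> iso_det t L \<noteq> 0 \<and> kol_det t L \<noteq> 0 \<and> act_t
        0 t L - act 1 t L > 0) (at_right 0)"
      by (rule eventually_elim2) blast
    then obtain t where t: "0 < t" "t < d / 2" "iso_det t L \<noteq> 0" "kol_det t L \<noteq> 0" "act_t 0 t L -
        act 1 t L > 0"
      using eventually_happens trivial_limit_at_right_real by blast
    have "dist (t, L) (0, L0) \<le> dist t 0 + dist L L0"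
      unfolding dist_Pair_Pair by (intro sqrt_sum_squares_le_sum) auto
    also have "\<dots> < d" using t L by (simp add: dist_real_def)
    finally have "dist (w (t, L)) z < e" by (rule d(2))
    moreover have "w (t, L) \<in> nondegenerate_region"
      using t s p size_w[of t L] excess_w[of t L]
      by (simp add: nondegenerate_region_def) (simp add: w_def moving_points_def)
    ultimately show "\<exists>y\<in>nondegenerate_region. dist y z < e" by blast
  qed
qed

text \<open>
  In a flat chart the actions are the action of the \<open>(s, p\<^sub>s)\<close> motion and the momenta of the
  chart. They are continued to the equilibria by \<open>A = 0\<close>.
\<close>

lemma action_coordinates:
  assumes chart: "flat_chart g W \<phi>" and q0: "q0 \<in> W" and z0: "(s0, q0, ps0, p0) \<in> nondegenerate_region"
  obtains B I where "action_hamiltonian G B c" "action_variables F W \<phi> I"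
    "\<And>z. z \<in> action_domain W \<Longrightarrow> F z = action_hamiltonian.action_energy G B c (I z)"
    "I (s0, q0, ps0, p0) \<in> action_hamiltonian.regular_actions G B c"
    "action_hamiltonian.drift_factor G B c (I (s0, q0, ps0, p0)) > 0"
    "kol_det (action_hamiltonian.action_excess G B c (I (s0, q0, ps0, p0)))
       (action_hamiltonian.action_log_size B c (I (s0, q0, ps0, p0))) \<noteq> 0"
    "iso_det (action_hamiltonian.action_excess G B c (I (s0, q0, ps0, p0)))
       (action_hamiltonian.action_log_size B c (I (s0, q0, ps0, p0))) \<noteq> 0"
proof -
  obtain B where B: "inverse_metric B"
    and detJ: "\<And>q. q \<in> W \<Longrightarrow> det (jacobian \<phi> (at q)) \<noteq> 0"
    and conorm: "\<And>q P. q \<in> W \<Longrightarrow> conorm_sq g q (transpose (jacobian \<phi> (at q)) *v P) = P \<bullet> (B *v P)"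
    using flat_chart_metric[OF chart q0 metric] by blast
  interpret inverse_metric B by (rule B)
  interpret ah: action_hamiltonian G B c by unfold_locales (rule c_pos)
  define I :: "'n phase \<Rightarrow> real^('n option)" where
    "I = (\<lambda>(s, q, ps, p). \<chi> i. case i of None \<Rightarrow> act 0 (excess_at (s, q, ps, p)) (size_at (s, q, ps, p))
       | Some i \<Rightarrow> (matrix_inv (transpose (jacobian \<phi> (at q))) *v p) $ i)"
  have mom: "momenta (I (s, q, ps, p)) = matrix_inv (transpose (jacobian \<phi> (at q))) *v p" for s q ps p
    by (simp add: I_def vec_eq_iff)
  have lift: "transpose (jacobian \<phi> (at q)) *v momenta (I (s, q, ps, p)) = p" if "q \<in> W" for s q ps p
  proof -
    have "det (transpose (jacobian \<phi> (at q))) \<noteq> 0" using detJ[OF that] by (simp add: det_transpose)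
    from matrix_inv_mult_vector[OF this] show ?thesis unfolding mom by blast
  qed
  have act_I: "I (s, q, ps, p) $ None = act 0 (excess_at (s, q, ps, p)) (size_at (s, q, ps, p))"
      for s q ps p
    by (simp add: I_def)
  have log_I: "ah.action_log_size (I (s, q, ps, p)) = size_at (s, q, ps, p)" if "q \<in> W" for s q ps p
    using conorm[OF that, of "momenta (I (s, q, ps, p))"] unfolding lift[OF that]
    by (simp add: ah.action_log_size_def log_size_def size_log_def)
  have exc_I: "ah.action_excess (I (s, q, ps, p)) = excess_at (s, q, ps, p)"
    if "s > 0" "q \<in> W" "p \<noteq> 0" for s q ps p
    unfolding ah.action_excess_def log_I[OF that(2)] act_I
    using excess_energy_nonneg[OF conorm_sq_pos[OF that(3)] that(1)] by (intro excess_act) simp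
  have energy: "F z = ah.action_energy (I z)" if "z \<in> action_domain W" for z
  proof -
    obtain s q ps p where z: "z = (s, q, ps, p)" "s > 0" "q \<in> W" "p \<noteq> 0"
      using \<open>z \<in> action_domain W\<close> by (auto simp: action_domain_def)
    show ?thesis
      unfolding z(1) ah.action_energy_def exc_I[OF z(2-4)] log_I[OF z(3)] F[OF z(2)]
      using c_pos by (simp add: excess_energy_def)
  qed
  have vars: "action_variables F W \<phi> I"
    unfolding action_variables_def
  proof clarify
    fix s q ps p assume "(s, q, ps, p) \<in> action_domain W"
    then have z: "s > 0" "q \<in> W" "p \<noteq> 0" by (auto simp: action_domain_def)
    have "thermostat_action F (s, q, ps, p) (I (s, q, ps, p) $ None)"
      unfolding act_I excess_at.simps size_at.simps
      by (rule thermostat_action_radial[OF F conorm_sq_pos[OF z(3)] z(1)])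
    then show "thermostat_action F (s, q, ps, p) (I (s, q, ps, p) $ None) \<and>
       transpose (jacobian \<phi> (at q)) *v (\<chi> i. I (s, q, ps, p) $ Some i) = p"
      using lift[OF z(2)] by (simp only: momenta_def)
  qed
  let ?J = "I (s0, q0, ps0, p0)"
  have z: "s0 > 0" "p0 \<noteq> 0" "excess_at (s0, q0, ps0, p0) > 0" using z0 by (auto simp:
      nondegenerate_region_def moving_points_def)
  have exc: "ah.action_excess ?J = excess_at (s0, q0, ps0, p0)" by (rule exc_I[OF z(1) q0 z(2)])
  have log: "ah.action_log_size ?J = size_at (s0, q0, ps0, p0)" by (rule log_I[OF q0])
  have "momenta ?J \<noteq> 0" using lift[OF q0, of s0 ps0 p0] z(2) by auto
  moreover have "(?J $ None, ah.action_log_size ?J) \<in> act_range"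
    unfolding act_range_def act_map_def act_I log using z(3)
    by (intro image_eqI[where x = "(excess_at (s0, q0, ps0, p0), size_at (s0, q0, ps0, p0))"]) auto
  ultimately have "?J \<in> ah.regular_actions" by (simp add: ah.regular_actions_def)
  moreover have "ah.drift_factor ?J > 0" "kol_det (ah.action_excess ?J) (ah.action_log_size ?J) \<noteq> 0"
    "iso_det (ah.action_excess ?J) (ah.action_log_size ?J) \<noteq> 0"
    unfolding ah.drift_factor_def exc log using z0 by (simp_all add: nondegenerate_region_def)
  ultimately show thesis
    using that[of B I] ah.action_hamiltonian_axioms vars energy by blast
qed

lemma kolmogorov_nondegenerate_on_nondegenerate_region: "kolmogorov_nondegenerate_on g F
    nondegenerate_region"
  unfolding nondegenerate_on_def
proof (clarify, intro conjI allI impI)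
  fix s q ps p assume z: "(s, q, ps, p) \<in> nondegenerate_region"
  then show "p \<noteq> 0" by (simp add: nondegenerate_region_def moving_points_def)
  fix W \<phi> assume chart: "flat_chart g W \<phi> \<and> q \<in> W"
  with z obtain B I where *: "action_hamiltonian G B c" "action_variables F W \<phi> I"
    "\<And>z. z \<in> action_domain W \<Longrightarrow> F z = action_hamiltonian.action_energy G B c (I z)"
    "I (s, q, ps, p) \<in> action_hamiltonian.regular_actions G B c"
    "action_hamiltonian.drift_factor G B c (I (s, q, ps, p)) > 0"
    "kol_det (action_hamiltonian.action_excess G B c (I (s, q, ps, p)))
       (action_hamiltonian.action_log_size B c (I (s, q, ps, p))) \<noteq> 0"
    using action_coordinates by blast
  then show "\<exists>I h. action_variables F W \<phi> I \<and> (\<forall>z\<in>action_domain W. F z = h (I z)) \<and>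
      kolmogorov_nondegenerate_at (I ` action_domain W) h (I (s, q, ps, p))"
    using action_hamiltonian.kolmogorov_nondegenerate_action_energy[OF *(1,4,5,6)] by blast
qed

lemma isoenergetically_nondegenerate_on_nondegenerate_region: "isoenergetically_nondegenerate_on g
    F nondegenerate_region"
  unfolding nondegenerate_on_def
proof (clarify, intro conjI allI impI)
  fix s q ps p assume z: "(s, q, ps, p) \<in> nondegenerate_region"
  then show "p \<noteq> 0" by (simp add: nondegenerate_region_def moving_points_def)
  fix W \<phi> assume chart: "flat_chart g W \<phi> \<and> q \<in> W"
  with z obtain B I where *: "action_hamiltonian G B c" "action_variables F W \<phi> I"
    "\<And>z. z \<in> action_domain W \<Longrightarrow> F z = action_hamiltonian.action_energy G B c (I z)"
    "I (s, q, ps, p) \<in> action_hamiltonian.regular_actions G B c"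
    "action_hamiltonian.drift_factor G B c (I (s, q, ps, p)) > 0"
    "iso_det (action_hamiltonian.action_excess G B c (I (s, q, ps, p)))
       (action_hamiltonian.action_log_size B c (I (s, q, ps, p))) \<noteq> 0"
    using action_coordinates by blast
  then show "\<exists>I h. action_variables F W \<phi> I \<and> (\<forall>z\<in>action_domain W. F z = h (I z)) \<and>
      isoenergetically_nondegenerate_at (I ` action_domain W) h (I (s, q, ps, p))"
    using action_hamiltonian.isoenergetically_nondegenerate_action_energy[OF *(1,4,5,6)] by blast
qed

end

theorem theorem1p3:
  fixes V :: "real^'n \<Rightarrow> real" and g :: "real^'n \<Rightarrow> real^'n^'n"
    and \<Omega> :: "real \<Rightarrow> real" and r k T :: real
    and F :: "real \<Rightarrow> 'n phase \<Rightarrow> real"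
  assumes "r > real (2 * CARD('n) + 2)"
    and "lattice_periodic V" and "Cr_on r UNIV V"
    and "flat_metric_on_torus g"
    and "k > 0" and "T > 0"
    and "\<forall>s>0. \<Omega> s > 0" and "Cr_on r {0<..} \<Omega>"
    and "\<And>\<epsilon>. F \<epsilon> = thermostated (mechanical_hamiltonian g V \<epsilon>)
                   (variable_mass_thermostat CARD('n) k T \<Omega>)"
  shows "\<exists>U. phase_open U \<and>
             thermostatic_equilibria (F 0) \<subseteq> closure U \<and>
             kolmogorov_nondegenerate_on g (F 0) U \<and>
             isoenergetically_nondegenerate_on g (F 0) U"
proof -
  define c where "c = real CARD('n) * k * T"
  have n: "CARD('n) \<ge> 1" by (simp add: Suc_leI)
  then have c: "c > 0" using assms(5,6) by (simp add: c_def)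
  have "real 4 \<le> r" using assms(1) n by linarith
  then have C4: "C_on 4 {0<..} \<Omega>" by (rule Cr_on_imp_C_on[OF assms(8)])
  interpret thermostat \<Omega> c
    using assms(7) C4 c by unfold_locales auto
  interpret torus_thermostat \<Omega> c g "F 0"
  proof
    show "riemannian_metric_on_torus g" using assms(4) by (simp add: flat_metric_on_torus_def)
    show "F 0 (s, q, ps, p) = radial_energy (conorm_sq g q p) s ps" if "s > 0" for s q ps p
      using that unfolding assms(9) radial_energy_def
      by (simp add: mechanical_hamiltonian_def variable_mass_thermostat_def
          conorm_sq_def matrix_vector_mult_scaleR c_def power2_eq_square field_simps)
  qed
  show ?thesis
    using phase_open_nondegenerate_region equilibria_in_closure
        kolmogorov_nondegenerate_on_nondegenerate_region
      isoenergetically_nondegenerate_on_nondegenerate_region by blast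
qed

end
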